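(* Let $\mathfrak A$ be a J-algebra or a relation algebra. If $\mathfrak A$ is tabular, then $\mathfrak A$ is representable.
   Context: A J-algebra is an algebra $\mathfrak A=\langle A,\cdot,0,1,;,{}^{\smile},1'\rangle$ (binary $\cdot$, $;$; unary ${}^{\smile}$; constants $0,1,1'$) satisfying for all $x,y,z$: $x\cdot(y\cdot z)=(x\cdot y)\cdot z$, $x\cdot y=y\cdot x$, $x\cdot x=x$, $x;(y;z)=(x;y);z$, $x;1'=x$, $(x\cdot y);z=(x\cdot y);z\cdot y;z$, $x^{\smile\smile}=x$, $(x;y)^{\smile}=y^{\smile};x^{\smile}$, $(x\cdot y)^{\smile}=x^{\smile}\cdot y^{\smile}$, $x;y\cdot z=(z;y^{\smile}\cdot x);(y\cdot x^{\smile};z)\cdot z$, $0\cdot x=0$, $x\cdot1=x$, $x;0=0$ (converse binds tightest, then $;$, then $\cdot$). A relation algebra is an algebra $\langle A,+,\cdot,-,0,1,;,{}^{\smile},1'\rangle$ satisfying Tarski's axioms: $+$ commutative and associative, $-(-x+-y)+-(-x+y)=x$, $;$ associative, $(x+y);z=x;z+y;z$, $x;1'=x$, $x^{\smile\smile}=x$, $(x+y)^{\smile}=x^{\smile}+y^{\smile}$, $(x;y)^{\smile}=y^{\smile};x^{\smile}$, $x^{\smile};-(x;y)+-y=-y$, $x\cdot y=-(-x+-y)$, $1=1'+-1'$, $0=-1$. In either case $x\le y$ means $x\cdot y=x$, and $x<y$ means $x\le y$ and $x\neq y$. An element $p$ is functional if $p^{\smile};p\le1'$. $\mathfrak A$ is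 tabular if for all $v,w\in A$ with $v<w$ there are functional $p,q$ with $0\ne p^{\smile};q\le w$ and $v\cdot p^{\smile};q=0$. For an equivalence relation $E$, let $\wp(E)$ be its set of subsets, $|$ composition of relations, $R^{-1}$ converse, and $\mathrm{Id}(E)=\{\langle x,x\rangle:\langle x,x\rangle\in E\}$. A J-algebra is representable if it is isomorphic to a subalgebra of $\langle\wp(E),\cap,\emptyset,E,|,{}^{-1},\mathrm{Id}(E)\rangle$ for some equivalence relation $E$; a relation algebra is representable if it is isomorphic to a subalgebra of $\langle\wp(E),\cup,\cap,\bar{\ },\emptyset,E,|,{}^{-1},\mathrm{Id}(E)\rangle$, where $\bar R=E\setminus R$, for some equivalence relation $E$. *)

theory Defs
  imports Main
begin

text \<open>
  Algebras are records with an explicit carrier. Relation algebras extend the signature of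
  J-algebras by join and complement, so the order, functional elements and tabularity are
  defined once, for both signatures.
\<close>

record 'a J_sig =
  carrier :: "'a set"
  meet :: "['a, 'a] \<Rightarrow> 'a"  (infixl \<open>\<sqdot>\<index>\<close> 70)
  zero :: 'a  (\<open>\<zero>\<index>\<close>)
  unit :: 'a  (\<open>\<one>\<index>\<close>)
  relmult :: "['a, 'a] \<Rightarrow> 'a"  (infixl \<open>;;\<index>\<close> 75)
  conv :: "'a \<Rightarrow> 'a"  (\<open>(_\<^sup>\<smile>\<index>)\<close> [1000] 1000)
  ident :: 'a  (\<open>\<one>''\<index>\<close>)

record 'a RA_sig = "'a J_sig" +
  join :: "['a, 'a] \<Rightarrow> 'a"  (infixl \<open>\<squnion>\<index>\<close> 65)
  compl :: "'a \<Rightarrow> 'a"  (\<open>(\<sim>\<index>_)\<close> [90] 90)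

locale J_structure =
  fixes A (structure)
  assumes meet_closed: "\<lbrakk>x \<in> carrier A; y \<in> carrier A\<rbrakk> \<Longrightarrow> x \<sqdot> y \<in> carrier A"
    and zero_closed: "\<zero> \<in> carrier A"
    and unit_closed: "\<one> \<in> carrier A"
    and relmult_closed: "\<lbrakk>x \<in> carrier A; y \<in> carrier A\<rbrakk> \<Longrightarrow> x ;; y \<in> carrier A"
    and conv_closed: "x \<in> carrier A \<Longrightarrow> x\<^sup>\<smile> \<in> carrier A"
    and ident_closed: "\<one>' \<in> carrier A"

locale RA_structure = J_structure +
  assumes join_closed: "\<lbrakk>x \<in> carrier A; y \<in> carrier A\<rbrakk> \<Longrightarrow> x \<squnion> y \<in> carrier A"
    and compl_closed: "x \<in> carrier A \<Longrightarrow> \<sim> x \<in> carrier A"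

locale J_algebra = J_structure +
  assumes meet_assoc:
      "\<lbrakk>x \<in> carrier A; y \<in> carrier A; z \<in> carrier A\<rbrakk> \<Longrightarrow> x \<sqdot> (y \<sqdot> z) = (x \<sqdot> y) \<sqdot> z"
    and meet_comm: "\<lbrakk>x \<in> carrier A; y \<in> carrier A\<rbrakk> \<Longrightarrow> x \<sqdot> y = y \<sqdot> x"
    and meet_idem: "x \<in> carrier A \<Longrightarrow> x \<sqdot> x = x"
    and relmult_assoc:
      "\<lbrakk>x \<in> carrier A; y \<in> carrier A; z \<in> carrier A\<rbrakk> \<Longrightarrow> x ;; (y ;; z) = (x ;; y) ;; z"
    and relmult_ident: "x \<in> carrier A \<Longrightarrow> x ;; \<one>' = x"
    and relmult_mono:
      "\<lbrakk>x \<in> carrier A; y \<in> carrier A; z \<in> carrier A\<rbrakk>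
        \<Longrightarrow> (x \<sqdot> y) ;; z = ((x \<sqdot> y) ;; z) \<sqdot> (y ;; z)"
    and conv_conv: "x \<in> carrier A \<Longrightarrow> (x\<^sup>\<smile>)\<^sup>\<smile> = x"
    and conv_relmult: "\<lbrakk>x \<in> carrier A; y \<in> carrier A\<rbrakk> \<Longrightarrow> (x ;; y)\<^sup>\<smile> = y\<^sup>\<smile> ;; x\<^sup>\<smile>"
    and conv_meet: "\<lbrakk>x \<in> carrier A; y \<in> carrier A\<rbrakk> \<Longrightarrow> (x \<sqdot> y)\<^sup>\<smile> = x\<^sup>\<smile> \<sqdot> y\<^sup>\<smile>"
    and rotation:
      "\<lbrakk>x \<in> carrier A; y \<in> carrier A; z \<in> carrier A\<rbrakk>
        \<Longrightarrow> (x ;; y) \<sqdot> z = (((z ;; y\<^sup>\<smile>) \<sqdot> x) ;; (y \<sqdot> (x\<^sup>\<smile> ;; z))) \<sqdot> z"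
    and zero_meet: "x \<in> carrier A \<Longrightarrow> \<zero> \<sqdot> x = \<zero>"
    and meet_unit: "x \<in> carrier A \<Longrightarrow> x \<sqdot> \<one> = x"
    and relmult_zero: "x \<in> carrier A \<Longrightarrow> x ;; \<zero> = \<zero>"

locale relation_algebra = RA_structure +
  assumes join_comm: "\<lbrakk>x \<in> carrier A; y \<in> carrier A\<rbrakk> \<Longrightarrow> x \<squnion> y = y \<squnion> x"
    and join_assoc:
      "\<lbrakk>x \<in> carrier A; y \<in> carrier A; z \<in> carrier A\<rbrakk> \<Longrightarrow> x \<squnion> (y \<squnion> z) = (x \<squnion> y) \<squnion> z"
    and huntington:
      "\<lbrakk>x \<in> carrier A; y \<in> carrier A\<rbrakk> \<Longrightarrow> \<sim>(\<sim>x \<squnion> \<sim>y) \<squnion> \<sim>(\<sim>x \<squnion> y) = x"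
    and relmult_assoc:
      "\<lbrakk>x \<in> carrier A; y \<in> carrier A; z \<in> carrier A\<rbrakk> \<Longrightarrow> x ;; (y ;; z) = (x ;; y) ;; z"
    and relmult_join_distrib:
      "\<lbrakk>x \<in> carrier A; y \<in> carrier A; z \<in> carrier A\<rbrakk> \<Longrightarrow> (x \<squnion> y) ;; z = (x ;; z) \<squnion> (y ;; z)"
    and relmult_ident: "x \<in> carrier A \<Longrightarrow> x ;; \<one>' = x"
    and conv_conv: "x \<in> carrier A \<Longrightarrow> (x\<^sup>\<smile>)\<^sup>\<smile> = x"
    and conv_join: "\<lbrakk>x \<in> carrier A; y \<in> carrier A\<rbrakk> \<Longrightarrow> (x \<squnion> y)\<^sup>\<smile> = x\<^sup>\<smile> \<squnion> y\<^sup>\<smile>"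
    and conv_relmult: "\<lbrakk>x \<in> carrier A; y \<in> carrier A\<rbrakk> \<Longrightarrow> (x ;; y)\<^sup>\<smile> = y\<^sup>\<smile> ;; x\<^sup>\<smile>"
    and tarski: "\<lbrakk>x \<in> carrier A; y \<in> carrier A\<rbrakk> \<Longrightarrow> (x\<^sup>\<smile> ;; \<sim>(x ;; y)) \<squnion> \<sim>y = \<sim>y"
    and meet_eq: "\<lbrakk>x \<in> carrier A; y \<in> carrier A\<rbrakk> \<Longrightarrow> x \<sqdot> y = \<sim>(\<sim>x \<squnion> \<sim>y)"
    and unit_eq: "\<one> = \<one>' \<squnion> \<sim>\<one>'"
    and zero_eq: "\<zero> = \<sim>\<one>"

definition leq :: "('a, 'm) J_sig_scheme \<Rightarrow> 'a \<Rightarrow> 'a \<Rightarrow> bool" where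
  "leq A x y \<longleftrightarrow> x \<sqdot>\<^bsub>A\<^esub> y = x"

definition lt :: "('a, 'm) J_sig_scheme \<Rightarrow> 'a \<Rightarrow> 'a \<Rightarrow> bool" where
  "lt A x y \<longleftrightarrow> leq A x y \<and> x \<noteq> y"

definition functional :: "('a, 'm) J_sig_scheme \<Rightarrow> 'a \<Rightarrow> bool" where
  "functional A p \<longleftrightarrow> leq A (p\<^sup>\<smile>\<^bsub>A\<^esub> ;;\<^bsub>A\<^esub> p) \<one>'\<^bsub>A\<^esub>"

definition tabular :: "('a, 'm) J_sig_scheme \<Rightarrow> bool" where
  "tabular A \<longleftrightarrow> (\<forall>v\<in>carrier A. \<forall>w\<in>carrier A. lt A v w \<longrightarrow>
     (\<exists>p\<in>carrier A. \<exists>q\<in>carrier A. functional A p \<and> functional A q \<and>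
        \<zero>\<^bsub>A\<^esub> \<noteq> p\<^sup>\<smile>\<^bsub>A\<^esub> ;;\<^bsub>A\<^esub> q \<and> leq A (p\<^sup>\<smile>\<^bsub>A\<^esub> ;;\<^bsub>A\<^esub> q) w \<and>
        v \<sqdot>\<^bsub>A\<^esub> (p\<^sup>\<smile>\<^bsub>A\<^esub> ;;\<^bsub>A\<^esub> q) = \<zero>\<^bsub>A\<^esub>))"

definition J_hom :: "('a \<Rightarrow> 'b) \<Rightarrow> ('a, 'm) J_sig_scheme \<Rightarrow> ('b, 'n) J_sig_scheme \<Rightarrow> bool" where
  "J_hom h A B \<longleftrightarrow> h ` carrier A \<subseteq> carrier B \<and>
     (\<forall>x\<in>carrier A. \<forall>y\<in>carrier A. h (x \<sqdot>\<^bsub>A\<^esub> y) = h x \<sqdot>\<^bsub>B\<^esub> h y) \<and>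
     h \<zero>\<^bsub>A\<^esub> = \<zero>\<^bsub>B\<^esub> \<and> h \<one>\<^bsub>A\<^esub> = \<one>\<^bsub>B\<^esub> \<and>
     (\<forall>x\<in>carrier A. \<forall>y\<in>carrier A. h (x ;;\<^bsub>A\<^esub> y) = h x ;;\<^bsub>B\<^esub> h y) \<and>
     (\<forall>x\<in>carrier A. h (x\<^sup>\<smile>\<^bsub>A\<^esub>) = (h x)\<^sup>\<smile>\<^bsub>B\<^esub>) \<and>
     h \<one>'\<^bsub>A\<^esub> = \<one>'\<^bsub>B\<^esub>"

definition RA_hom :: "('a \<Rightarrow> 'b) \<Rightarrow> ('a, 'm) RA_sig_scheme \<Rightarrow> ('b, 'n) RA_sig_scheme \<Rightarrow> bool" where
  "RA_hom h A B \<longleftrightarrow> J_hom h A B \<and>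
     (\<forall>x\<in>carrier A. \<forall>y\<in>carrier A. h (x \<squnion>\<^bsub>A\<^esub> y) = h x \<squnion>\<^bsub>B\<^esub> h y) \<and>
     (\<forall>x\<in>carrier A. h (\<sim>\<^bsub>A\<^esub> x) = \<sim>\<^bsub>B\<^esub> (h x))"

definition J_isomorphic :: "('a, 'm) J_sig_scheme \<Rightarrow> ('b, 'n) J_sig_scheme \<Rightarrow> bool" where
  "J_isomorphic A B \<longleftrightarrow> (\<exists>h. bij_betw h (carrier A) (carrier B) \<and> J_hom h A B)"

definition RA_isomorphic :: "('a, 'm) RA_sig_scheme \<Rightarrow> ('b, 'n) RA_sig_scheme \<Rightarrow> bool" where
  "RA_isomorphic A B \<longleftrightarrow> (\<exists>h. bij_betw h (carrier A) (carrier B) \<and> RA_hom h A B)"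

definition J_subalgebra :: "('a, 'm) J_sig_scheme \<Rightarrow> ('a, 'm) J_sig_scheme \<Rightarrow> bool" where
  "J_subalgebra B A \<longleftrightarrow>
     (\<exists>S \<subseteq> carrier A. B = A\<lparr>carrier := S\<rparr>) \<and> J_structure B"

definition RA_subalgebra :: "('a, 'm) RA_sig_scheme \<Rightarrow> ('a, 'm) RA_sig_scheme \<Rightarrow> bool" where
  "RA_subalgebra B A \<longleftrightarrow>
     (\<exists>S \<subseteq> carrier A. B = A\<lparr>carrier := S\<rparr>) \<and> RA_structure B"

definition J_powerset :: "'u rel \<Rightarrow> 'u rel J_sig" where
  "J_powerset E = \<lparr>carrier = Pow E, meet = (\<inter>), zero = {}, unit = E,
     relmult = (O), conv = converse, ident = {(x, x) |x. (x, x) \<in> E}\<rparr>"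

definition RA_powerset :: "'u rel \<Rightarrow> 'u rel RA_sig" where
  "RA_powerset E = \<lparr>carrier = Pow E, meet = (\<inter>), zero = {}, unit = E,
     relmult = (O), conv = converse, ident = {(x, x) |x. (x, x) \<in> E},
     join = (\<union>), compl = (\<lambda>R. E - R)\<rparr>"

definition J_representable_over :: "'u rel \<Rightarrow> 'a J_sig \<Rightarrow> bool" where
  "J_representable_over E A \<longleftrightarrow> equiv (Field E) E \<and>
     (\<exists>B. J_subalgebra B (J_powerset E) \<and> J_isomorphic A B)"

definition RA_representable_over :: "'u rel \<Rightarrow> 'a RA_sig \<Rightarrow> bool" where
  "RA_representable_over E A \<longleftrightarrow> equiv (Field E) E \<and>
     (\<exists>B. RA_subalgebra B (RA_powerset E) \<and> RA_isomorphic A B)"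

text \<open>
  The field of \<open>E\<close> may be any set, but HOL cannot quantify over types inside a formula.
  The type \<open>'a option list\<close> is infinite and at least as large as any algebra with elements
  in \<open>'a\<close>; by the downward Loewenheim-Skolem argument below (lemmas
  \<open>J_representableI\<close> and \<open>RA_representableI\<close>), an algebra that has a representation over an
  equivalence relation on any type whatsoever also has one over this type, so fixing it loses
  nothing.
\<close>

definition J_representable :: "'a J_sig \<Rightarrow> bool" where
  "J_representable A \<longleftrightarrow> (\<exists>E :: 'a option list rel. J_representable_over E A)"

definition RA_representable :: "'a RA_sig \<Rightarrow> bool" where
  "RA_representable A \<longleftrightarrow> (\<exists>E :: 'a option list rel. RA_representable_over E A)"


subsection \<open>Independence of the base type\<close>

lemma J_structure_image:
  assumes "J_structure A" and h: "J_hom h A B"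
  shows "J_structure (B\<lparr>carrier := h ` carrier A\<rparr>)"
proof -
  interpret J_structure A by fact
  have h_ops: "h x \<sqdot>\<^bsub>B\<^esub> h y = h (x \<sqdot>\<^bsub>A\<^esub> y)" "h x ;;\<^bsub>B\<^esub> h y = h (x ;;\<^bsub>A\<^esub> y)"
    "(h x)\<^sup>\<smile>\<^bsub>B\<^esub> = h (x\<^sup>\<smile>\<^bsub>A\<^esub>)" if "x \<in> carrier A" "y \<in> carrier A" for x y
    using h that unfolding J_hom_def by simp_all
  have h_consts: "\<zero>\<^bsub>B\<^esub> = h \<zero>\<^bsub>A\<^esub>" "\<one>\<^bsub>B\<^esub> = h \<one>\<^bsub>A\<^esub>" "\<one>'\<^bsub>B\<^esub> = h \<one>'\<^bsub>A\<^esub>"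
    using h unfolding J_hom_def by simp_all
  show ?thesis
    by unfold_locales (auto simp: h_ops h_consts meet_closed zero_closed unit_closed
        relmult_closed conv_closed ident_closed)
qed

lemma RA_structure_image:
  assumes "RA_structure A" and h: "RA_hom h A B"
  shows "RA_structure (B\<lparr>carrier := h ` carrier A\<rparr>)"
proof -
  interpret RA_structure A by fact
  have h_ops: "h x \<squnion>\<^bsub>B\<^esub> h y = h (x \<squnion>\<^bsub>A\<^esub> y)" "\<sim>\<^bsub>B\<^esub> (h x) = h (\<sim>\<^bsub>A\<^esub> x)"
    if "x \<in> carrier A" "y \<in> carrier A" for x y
    using h that unfolding RA_hom_def by simp_all
  have "J_hom h A B" using h by (simp add: RA_hom_def)
  from J_structure_image[OF J_structure_axioms this] show ?thesis
    by (intro RA_structure.intro RA_structure_axioms.intro)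
      (auto simp: h_ops join_closed compl_closed)
qed

lemma J_representable_over_iff:
  assumes "J_structure A"
  shows "J_representable_over E A \<longleftrightarrow>
    equiv (Field E) E \<and> (\<exists>h. inj_on h (carrier A) \<and> J_hom h A (J_powerset E))"
proof (intro iffI)
  assume "J_representable_over E A"
  then obtain S h where E: "equiv (Field E) E" and S: "S \<subseteq> carrier (J_powerset E)"
    and bij: "bij_betw h (carrier A) S" and h: "J_hom h A ((J_powerset E)\<lparr>carrier := S\<rparr>)"
    unfolding J_representable_over_def J_subalgebra_def J_isomorphic_def by auto
  have "h ` carrier A \<subseteq> carrier (J_powerset E)"
    using S bij by (simp add: bij_betw_def)
  then have "J_hom h A (J_powerset E)"
    using h unfolding J_hom_def by simp
  moreover have "inj_on h (carrier A)"
    using bij by (rule bij_betw_imp_inj_on)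
  ultimately show "equiv (Field E) E \<and> (\<exists>h. inj_on h (carrier A) \<and> J_hom h A (J_powerset E))"
    using E by blast
next
  assume "equiv (Field E) E \<and> (\<exists>h. inj_on h (carrier A) \<and> J_hom h A (J_powerset E))"
  then obtain h where E: "equiv (Field E) E" and inj: "inj_on h (carrier A)"
    and h: "J_hom h A (J_powerset E)" by blast
  let ?B = "(J_powerset E)\<lparr>carrier := h ` carrier A\<rparr>"
  have "J_structure ?B"
    using J_structure_image[OF assms h] .
  moreover have "h ` carrier A \<subseteq> carrier (J_powerset E)"
    using h by (simp add: RA_hom_def J_hom_def)
  ultimately have "J_subalgebra ?B (J_powerset E)"
    unfolding J_subalgebra_def by blast
  moreover have "J_isomorphic A ?B"
    using inj h unfolding J_isomorphic_def bij_betw_def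
    by (intro exI[of _ h]) (simp add: RA_hom_def J_hom_def)
  ultimately show "J_representable_over E A"
    using E unfolding J_representable_over_def by blast
qed

lemma RA_representable_over_iff:
  assumes "RA_structure A"
  shows "RA_representable_over E A \<longleftrightarrow>
    equiv (Field E) E \<and> (\<exists>h. inj_on h (carrier A) \<and> RA_hom h A (RA_powerset E))"
proof (intro iffI)
  assume "RA_representable_over E A"
  then obtain S h where E: "equiv (Field E) E" and S: "S \<subseteq> carrier (RA_powerset E)"
    and bij: "bij_betw h (carrier A) S" and h: "RA_hom h A ((RA_powerset E)\<lparr>carrier := S\<rparr>)"
    unfolding RA_representable_over_def RA_subalgebra_def RA_isomorphic_def by auto
  have "h ` carrier A \<subseteq> carrier (RA_powerset E)"
    using S bij by (simp add: bij_betw_def)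
  then have "RA_hom h A (RA_powerset E)"
    using h unfolding RA_hom_def J_hom_def by simp
  moreover have "inj_on h (carrier A)"
    using bij by (rule bij_betw_imp_inj_on)
  ultimately show "equiv (Field E) E \<and> (\<exists>h. inj_on h (carrier A) \<and> RA_hom h A (RA_powerset E))"
    using E by blast
next
  assume "equiv (Field E) E \<and> (\<exists>h. inj_on h (carrier A) \<and> RA_hom h A (RA_powerset E))"
  then obtain h where E: "equiv (Field E) E" and inj: "inj_on h (carrier A)"
    and h: "RA_hom h A (RA_powerset E)" by blast
  let ?B = "(RA_powerset E)\<lparr>carrier := h ` carrier A\<rparr>"
  have "RA_structure ?B"
    using RA_structure_image[OF assms h] .
  moreover have "h ` carrier A \<subseteq> carrier (RA_powerset E)"
    using h by (simp add: RA_hom_def J_hom_def)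
  ultimately have "RA_subalgebra ?B (RA_powerset E)"
    unfolding RA_subalgebra_def by blast
  moreover have "RA_isomorphic A ?B"
    using inj h unfolding RA_isomorphic_def bij_betw_def
    by (intro exI[of _ h]) (simp add: RA_hom_def J_hom_def)
  ultimately show "RA_representable_over E A"
    using E unfolding RA_representable_over_def by blast
qed

datatype 'a skolem =
  Left 'a 'a | Right 'a 'a | Via 'a 'a "'a skolem" "'a skolem"

primrec code :: "'a skolem \<Rightarrow> 'a option list" where
  "code (Left a b) = [Some a, Some b]"
| "code (Right a b) = [Some a, None, Some b]"
| "code (Via a b s t) = None # Some a # Some b # code s @ code t"

lemma code_append_inj: "code s @ xs = code t @ ys \<Longrightarrow> s = t \<and> xs = ys"
proof (induction s arbitrary: t xs ys)
  case (Left a b)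
  then show ?case by (cases t) auto
next
  case (Right a b)
  then show ?case by (cases t) auto
next
  case (Via a b u v)
  show ?case
  proof (cases t)
    case (Via a' b' u' v')
    then have eq: "a = a'" "b = b'" "code u @ (code v @ xs) = code u' @ (code v' @ ys)"
      using Via.prems by auto
    from Via.IH(1)[OF eq(3)] have "u = u'" "code v @ xs = code v' @ ys" by auto
    with Via.IH(2) Via eq show ?thesis by blast
  qed (use Via.prems in auto)
qed

lemma inj_code: "inj code"
  using code_append_inj[where xs = "[]" and ys = "[]"] by (auto intro: injI)

primrec skolem_eval :: "('a \<Rightarrow> 'u rel) \<Rightarrow> 'a skolem \<Rightarrow> 'u" where
  "skolem_eval h (Left a b) = fst (SOME r. (r \<in> h a) \<noteq> (r \<in> h b))"
| "skolem_eval h (Right a b) = snd (SOME r. (r \<in> h a) \<noteq> (r \<in> h b))"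
| "skolem_eval h (Via a b s t) =
     (SOME y. (skolem_eval h s, y) \<in> h a \<and> (y, skolem_eval h t) \<in> h b)"

lemma skolem_points:
  fixes h :: "'a \<Rightarrow> 'u rel"
  obtains T :: "'a option list set" and k :: "'a option list \<Rightarrow> 'u"
  where "inj_on k T"
    and "\<And>a b. h a \<noteq> h b \<Longrightarrow> \<exists>s\<in>T. \<exists>t\<in>T. ((k s, k t) \<in> h a) \<noteq> ((k s, k t) \<in> h b)"
    and "\<And>a b s t. \<lbrakk>s \<in> T; t \<in> T; (k s, k t) \<in> h a O h b\<rbrakk>
           \<Longrightarrow> \<exists>y\<in>T. (k s, k y) \<in> h a \<and> (k y, k t) \<in> h b"
proof -
  let ?U = "range (skolem_eval h)"
  define g where "g u = code (inv (skolem_eval h) u)" for u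
  have "inj_on g ?U"
    unfolding g_def by (intro inj_onI) (metis f_inv_into_f injD inj_code)
  define T where "T = g ` ?U"
  define k where "k = inv_into ?U g"
  have kT: "inj_on k T" "k ` T = ?U"
    using \<open>inj_on g ?U\<close> unfolding T_def k_def by (simp_all add: inj_on_inv_into)
  have onto: "\<exists>t\<in>T. k t = skolem_eval h e" for e
    using kT(2) by (metis imageE rangeI)
  show thesis
  proof (rule that[OF kT(1)])
    fix a b assume "h a \<noteq> h b"
    define r where "r = (SOME r. (r \<in> h a) \<noteq> (r \<in> h b))"
    have "\<exists>r. (r \<in> h a) \<noteq> (r \<in> h b)" using \<open>h a \<noteq> h b\<close> by blast
    then have r: "(r \<in> h a) \<noteq> (r \<in> h b)" unfolding r_def by (rule someI_ex)
    obtain s t where "s \<in> T" "k s = fst r" "t \<in> T" "k t = snd r"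
      using onto[of "Left a b"] onto[of "Right a b"] by (auto simp: r_def)
    with r show "\<exists>s\<in>T. \<exists>t\<in>T. ((k s, k t) \<in> h a) \<noteq> ((k s, k t) \<in> h b)"
      by (intro bexI[of _ s] bexI[of _ t]) simp_all
  next
    fix a b s t assume st: "s \<in> T" "t \<in> T" "(k s, k t) \<in> h a O h b"
    have "k s \<in> ?U" "k t \<in> ?U" using st kT(2) by blast+
    then obtain e f where ef: "k s = skolem_eval h e" "k t = skolem_eval h f" by blast
    define z where "z = (SOME y. (k s, y) \<in> h a \<and> (y, k t) \<in> h b)"
    have "\<exists>y. (k s, y) \<in> h a \<and> (y, k t) \<in> h b" using st by blast
    then have "(k s, z) \<in> h a \<and> (z, k t) \<in> h b" unfolding z_def by (rule someI_ex)
    moreover obtain y where "y \<in> T" "k y = z"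
      using onto[of "Via a b e f"] by (auto simp: z_def ef)
    ultimately show "\<exists>y\<in>T. (k s, k y) \<in> h a \<and> (k y, k t) \<in> h b" by blast
  qed
qed

lemma equiv_pullback:
  assumes "equiv (Field E) E" and F: "F = {(s, t). s \<in> T \<and> t \<in> T \<and> (k s, k t) \<in> E}"
  shows "equiv (Field F) F"
proof (rule equivI)
  show "F \<subseteq> Field F \<times> Field F" by (auto simp: Field_def)
  have E: "sym E" "trans E" using assms by (auto simp: equiv_def)
  show "sym F" using E unfolding F sym_def by auto
  show "trans F" using E unfolding F trans_def by blast
  show "refl_on (Field F) F"
    using E unfolding F refl_on_def Field_def sym_def trans_def by blast
qed

lemma J_hom_pullback:
  assumes A: "J_structure A" and h: "J_hom h A (J_powerset E)" and inj: "inj_on k T"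
    and wit: "\<And>a b s t. \<lbrakk>s \<in> T; t \<in> T; (k s, k t) \<in> h a O h b\<rbrakk>
           \<Longrightarrow> \<exists>y\<in>T. (k s, k y) \<in> h a \<and> (k y, k t) \<in> h b"
    and P: "\<And>R. P R = {(s, t). s \<in> T \<and> t \<in> T \<and> (k s, k t) \<in> R}"
  shows "J_hom (\<lambda>a. P (h a)) A (J_powerset (P E))"
proof -
  have id: "P {(x, x) |x. (x, x) \<in> E} = {(x, x) |x. (x, x) \<in> P E}"
    using inj unfolding P inj_on_def by auto
  have comp: "P (h a O h b) = P (h a) O P (h b)" for a b
    using wit unfolding P by auto blast
  show ?thesis
    using h unfolding J_hom_def
    by (simp add: J_powerset_def id comp) (auto simp: P)
qed

lemma J_representableI:
  fixes E :: "'u rel"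
  assumes A: "J_structure A" and "J_representable_over E A"
  shows "J_representable A"
proof -
  obtain h where E: "equiv (Field E) E" and inj: "inj_on h (carrier A)"
    and h: "J_hom h A (J_powerset E)"
    using assms J_representable_over_iff by blast
  obtain T :: "'a option list set" and k where k: "inj_on k T"
    and sep: "\<And>a b. h a \<noteq> h b \<Longrightarrow> \<exists>s\<in>T. \<exists>t\<in>T. ((k s, k t) \<in> h a) \<noteq> ((k s, k t) \<in> h b)"
    and wit: "\<And>a b s t. \<lbrakk>s \<in> T; t \<in> T; (k s, k t) \<in> h a O h b\<rbrakk>
           \<Longrightarrow> \<exists>y\<in>T. (k s, k y) \<in> h a \<and> (k y, k t) \<in> h b"
    using skolem_points[of h] by metis
  define P where "P R = {(s, t). s \<in> T \<and> t \<in> T \<and> (k s, k t) \<in> R}" for R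
  have "J_hom (\<lambda>a. P (h a)) A (J_powerset (P E))"
    using J_hom_pullback[OF A h k wit P_def] .
  moreover have "inj_on (\<lambda>a. P (h a)) (carrier A)"
  proof (rule inj_onI)
    fix a b assume "a \<in> carrier A" "b \<in> carrier A" "P (h a) = P (h b)"
    then show "a = b" using sep[of a b] inj unfolding P_def inj_on_def by blast
  qed
  ultimately have "J_representable_over (P E) A"
    using equiv_pullback[OF E P_def] J_representable_over_iff[OF A] by blast
  then show ?thesis unfolding J_representable_def by blast
qed

lemma RA_representableI:
  fixes E :: "'u rel"
  assumes A: "RA_structure A" and "RA_representable_over E A"
  shows "RA_representable A"
proof -
  obtain h where E: "equiv (Field E) E" and inj: "inj_on h (carrier A)"
    and h: "RA_hom h A (RA_powerset E)"
    using assms RA_representable_over_iff by blast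
  obtain T :: "'a option list set" and k where k: "inj_on k T"
    and sep: "\<And>a b. h a \<noteq> h b \<Longrightarrow> \<exists>s\<in>T. \<exists>t\<in>T. ((k s, k t) \<in> h a) \<noteq> ((k s, k t) \<in> h b)"
    and wit: "\<And>a b s t. \<lbrakk>s \<in> T; t \<in> T; (k s, k t) \<in> h a O h b\<rbrakk>
           \<Longrightarrow> \<exists>y\<in>T. (k s, k y) \<in> h a \<and> (k y, k t) \<in> h b"
    using skolem_points[of h] by metis
  define P where "P R = {(s, t). s \<in> T \<and> t \<in> T \<and> (k s, k t) \<in> R}" for R
  have hJ: "J_hom h A (J_powerset E)"
    using h by (simp add: RA_hom_def J_hom_def RA_powerset_def J_powerset_def)
  have "J_hom (\<lambda>a. P (h a)) A (J_powerset (P E))"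
    using J_hom_pullback[OF RA_structure.axioms(1)[OF A] hJ k wit P_def] .
  then have "RA_hom (\<lambda>a. P (h a)) A (RA_powerset (P E))"
    using h unfolding RA_hom_def
    by (simp add: J_hom_def RA_powerset_def J_powerset_def) (auto simp: P_def)
  moreover have "inj_on (\<lambda>a. P (h a)) (carrier A)"
  proof (rule inj_onI)
    fix a b assume "a \<in> carrier A" "b \<in> carrier A" "P (h a) = P (h b)"
    then show "a = b" using sep[of a b] inj unfolding P_def inj_on_def by blast
  qed
  ultimately have "RA_representable_over (P E) A"
    using equiv_pullback[OF E P_def] RA_representable_over_iff[OF A] by blast
  then show ?thesis unfolding RA_representable_def by blast
qed

end

theory Submission
  imports Defs
begin

text \<open>
  Think of a nonzero subidentity \<open>e\<close> as a set of generic points and of functional elements that are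
  total on \<open>e\<close> as points varying over \<open>e\<close>. A statement that \<open>a\<close> relates two varying points can be
  decided by shrinking \<open>e\<close>. If \<open>a ;; b\<close> relates two of them, tabularity supplies functional elements
  \<open>s\<close> and \<open>t\<close> such that, after everything is pulled back along \<open>s\<close>, the element \<open>t\<close> is a point
  in between. So every finite set of requirements on named points can be met, and by compactness
  there is a truth assignment to all statements that is locally of this form. Dividing by the
  identity turns it into a homomorphism into an algebra of relations, which can be chosen so that a
  prescribed nonzero element is sent to a nonempty relation. By tabularity distinct elements differ
  by a nonzero element below one and disjoint from the other, so the disjoint union of these
  homomorphisms is injective. In a relation algebra a refuted statement \<open>a\<close> is one for which the
  complement of \<open>a\<close> is satisfied, so complements are preserved as well.
\<close>

subsection \<open>Arithmetic of J-algebras\<close>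

context J_algebra
begin

abbreviation le (infix \<open>\<preceq>\<close> 50) where "x \<preceq> y \<equiv> leq A x y"

declare meet_closed [simp, intro] zero_closed [simp, intro] unit_closed [simp, intro]
  relmult_closed [simp, intro] conv_closed [simp, intro] ident_closed [simp, intro]

section \<open>Order, monotonicity and the constants\<close>

lemma le_refl [simp]: "x \<in> carrier A \<Longrightarrow> x \<preceq> x"
  by (simp add: leq_def meet_idem)

lemma le_trans:
  "\<lbrakk>x \<preceq> y; y \<preceq> z; x \<in> carrier A; y \<in> carrier A; z \<in> carrier A\<rbrakk> \<Longrightarrow> x \<preceq> z"
  unfolding leq_def by (metis meet_assoc)

lemma le_antisym: "\<lbrakk>x \<preceq> y; y \<preceq> x; x \<in> carrier A; y \<in> carrier A\<rbrakk> \<Longrightarrow> x = y"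
  unfolding leq_def by (metis meet_comm)

lemma meet_le1 [simp]: "\<lbrakk>x \<in> carrier A; y \<in> carrier A\<rbrakk> \<Longrightarrow> x \<sqdot> y \<preceq> x"
  unfolding leq_def by (metis meet_assoc meet_comm meet_idem)

lemma meet_le2 [simp]: "\<lbrakk>x \<in> carrier A; y \<in> carrier A\<rbrakk> \<Longrightarrow> x \<sqdot> y \<preceq> y"
  unfolding leq_def by (metis meet_assoc meet_idem)

lemma le_meet_iff:
  "\<lbrakk>x \<in> carrier A; y \<in> carrier A; z \<in> carrier A\<rbrakk> \<Longrightarrow> x \<preceq> y \<sqdot> z \<longleftrightarrow> x \<preceq> y \<and> x \<preceq> z"
  by (metis le_trans meet_le1 meet_le2 meet_assoc leq_def meet_closed)

lemma meet_mono_left: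
  "\<lbrakk>x \<preceq> y; x \<in> carrier A; y \<in> carrier A; z \<in> carrier A\<rbrakk> \<Longrightarrow> x \<sqdot> z \<preceq> y \<sqdot> z"
  by (metis le_meet_iff le_trans meet_closed meet_le1 meet_le2)

lemma le_unit [simp]: "x \<in> carrier A \<Longrightarrow> x \<preceq> \<one>"
  by (simp add: leq_def meet_unit)

lemma zero_le [simp]: "x \<in> carrier A \<Longrightarrow> \<zero> \<preceq> x"
  by (simp add: leq_def zero_meet)

lemma le_zero: "\<lbrakk>x \<preceq> \<zero>; x \<in> carrier A\<rbrakk> \<Longrightarrow> x = \<zero>"
  by (simp add: le_antisym)

lemma disjoint_mono:
  "\<lbrakk>x \<preceq> y; y \<sqdot> z = \<zero>; x \<in> carrier A; y \<in> carrier A; z \<in> carrier A\<rbrakk> \<Longrightarrow> x \<sqdot> z = \<zero>"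
  by (metis le_zero meet_closed meet_mono_left)

lemma conv_mono: "\<lbrakk>x \<preceq> y; x \<in> carrier A; y \<in> carrier A\<rbrakk> \<Longrightarrow> x\<^sup>\<smile> \<preceq> y\<^sup>\<smile>"
  unfolding leq_def by (metis conv_meet)

lemma relmult_mono_left:
  "\<lbrakk>x \<preceq> y; x \<in> carrier A; y \<in> carrier A; z \<in> carrier A\<rbrakk> \<Longrightarrow> x ;; z \<preceq> y ;; z"
  unfolding leq_def by (metis relmult_mono)

lemma relmult_mono_right:
  assumes "x \<preceq> y" "x \<in> carrier A" "y \<in> carrier A" "z \<in> carrier A"
  shows "z ;; x \<preceq> z ;; y"
proof -
  have "x\<^sup>\<smile> ;; z\<^sup>\<smile> \<preceq> y\<^sup>\<smile> ;; z\<^sup>\<smile>"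
    using assms by (simp add: conv_mono relmult_mono_left)
  then have "(x\<^sup>\<smile> ;; z\<^sup>\<smile>)\<^sup>\<smile> \<preceq> (y\<^sup>\<smile> ;; z\<^sup>\<smile>)\<^sup>\<smile>"
    using assms by (simp add: conv_mono)
  then show ?thesis using assms by (simp add: conv_relmult conv_conv)
qed

lemma relmult_mono2:
  "\<lbrakk>x \<preceq> x'; y \<preceq> y'; x \<in> carrier A; x' \<in> carrier A; y \<in> carrier A; y' \<in> carrier A\<rbrakk>
    \<Longrightarrow> x ;; y \<preceq> x' ;; y'"
  by (meson le_trans relmult_closed relmult_mono_left relmult_mono_right)

lemma conv_ident [simp]: "\<one>'\<^sup>\<smile> = \<one>'"
  by (metis conv_closed conv_conv conv_relmult ident_closed relmult_ident)

lemma ident_relmult [simp]: "x \<in> carrier A \<Longrightarrow> \<one>' ;; x = x"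
  by (metis conv_closed conv_conv conv_ident conv_relmult ident_closed relmult_ident)

lemma conv_zero [simp]: "\<zero>\<^sup>\<smile> = \<zero>"
  by (metis conv_closed conv_conv conv_mono le_zero zero_closed zero_le)

lemma zero_relmult [simp]: "x \<in> carrier A \<Longrightarrow> \<zero> ;; x = \<zero>"
  by (metis conv_closed conv_conv conv_relmult conv_zero relmult_zero zero_closed)

lemma conv_eq_zero: "x \<in> carrier A \<Longrightarrow> x\<^sup>\<smile> = \<zero> \<longleftrightarrow> x = \<zero>"
  by (metis conv_conv conv_zero)

text \<open>Dedekind's modular law: of the two restrictions in the rotation axiom only that on the
  second factor is kept, the first factor being enlarged to \<open>x\<close>.\<close>

lemma modular:
  assumes "x \<in> carrier A" "y \<in> carrier A" "z \<in> carrier A"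
  shows "(x ;; y) \<sqdot> z \<preceq> x ;; (y \<sqdot> (x\<^sup>\<smile> ;; z))"
proof -
  have "(x ;; y) \<sqdot> z \<preceq> ((z ;; y\<^sup>\<smile>) \<sqdot> x) ;; (y \<sqdot> (x\<^sup>\<smile> ;; z))"
    using assms by (subst rotation) simp_all
  moreover have "((z ;; y\<^sup>\<smile>) \<sqdot> x) ;; (y \<sqdot> (x\<^sup>\<smile> ;; z)) \<preceq> x ;; (y \<sqdot> (x\<^sup>\<smile> ;; z))"
    using assms by (simp add: relmult_mono_left)
  ultimately show ?thesis using assms by (meson le_trans conv_closed meet_closed relmult_closed)
qed

text \<open>One implication suffices: if the second meet is \<open>\<zero>\<close>, the modular law
  bounds the first by \<open>x ;; \<zero>\<close>. Replacing \<open>x\<close> by its converse and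
  exchanging \<open>y\<close> and \<open>z\<close> gives the other direction.\<close>

lemma schroeder_left:
  assumes "x \<in> carrier A" "y \<in> carrier A" "z \<in> carrier A"
  shows "(x ;; y) \<sqdot> z = \<zero> \<longleftrightarrow> (x\<^sup>\<smile> ;; z) \<sqdot> y = \<zero>"
proof -
  have *: "(x ;; y) \<sqdot> z = \<zero>"
    if "x \<in> carrier A" "y \<in> carrier A" "z \<in> carrier A" "(x\<^sup>\<smile> ;; z) \<sqdot> y = \<zero>" for x y z
    using modular[of x y z] that by (simp add: meet_comm relmult_zero le_zero)
  show ?thesis
    using *[of x y z] *[of "x\<^sup>\<smile>" z y] assms by (auto simp: conv_conv)
qed

lemma schroeder_right:
  assumes "x \<in> carrier A" "y \<in> carrier A" "z \<in> carrier A"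
  shows "(x ;; y) \<sqdot> z = \<zero> \<longleftrightarrow> (z ;; y\<^sup>\<smile>) \<sqdot> x = \<zero>"
proof -
  have "(x ;; y) \<sqdot> z = \<zero> \<longleftrightarrow> (y\<^sup>\<smile> ;; x\<^sup>\<smile>) \<sqdot> z\<^sup>\<smile> = \<zero>"
    using assms conv_eq_zero[of "(x ;; y) \<sqdot> z"] by (simp add: conv_meet conv_relmult)
  also have "\<dots> \<longleftrightarrow> (y ;; z\<^sup>\<smile>) \<sqdot> x\<^sup>\<smile> = \<zero>"
    using assms by (simp add: schroeder_left[of "y\<^sup>\<smile>"] conv_conv)
  also have "\<dots> \<longleftrightarrow> (z ;; y\<^sup>\<smile>) \<sqdot> x = \<zero>"
    using assms conv_eq_zero[of "(z ;; y\<^sup>\<smile>) \<sqdot> x"] by (simp add: conv_meet conv_relmult conv_conv)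
  finally show ?thesis .
qed

text \<open>The subidentity part of \<open>y ;; y\<^sup>\<smile>\<close> is the domain of
  \<open>y\<close>. The modular law for \<open>(y ;; z) \<sqdot> e\<close> brings \<open>e\<close>
  to the right end, where it is enlarged to \<open>\<one>'\<close>.\<close>

lemma subident_le_domain:
  assumes "e \<preceq> y ;; z" "e \<preceq> \<one>'" "e \<in> carrier A" "y \<in> carrier A" "z \<in> carrier A"
  shows "e \<preceq> y ;; y\<^sup>\<smile>"
proof -
  have "e = (y ;; z) \<sqdot> e" using assms by (simp add: leq_def meet_comm)
  then have "e \<preceq> y ;; (z \<sqdot> (y\<^sup>\<smile> ;; e))" using modular[of y z e] assms by simp
  moreover have "y ;; (z \<sqdot> (y\<^sup>\<smile> ;; e)) \<preceq> y ;; (y\<^sup>\<smile> ;; e)"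
    using assms by (intro relmult_mono_right) simp_all
  moreover have "y ;; (y\<^sup>\<smile> ;; e) \<preceq> y ;; (y\<^sup>\<smile> ;; \<one>')"
    using assms by (intro relmult_mono_right) simp_all
  ultimately have "e \<preceq> y ;; (y\<^sup>\<smile> ;; \<one>')"
    using assms by (meson le_trans conv_closed ident_closed meet_closed relmult_closed)
  then show ?thesis using assms by (simp add: relmult_ident)
qed

lemma subident_conv:
  assumes "e \<preceq> \<one>'" "e \<in> carrier A"
  shows "e\<^sup>\<smile> = e"
proof -
  have "e \<preceq> e ;; e\<^sup>\<smile>"
    using assms by (intro subident_le_domain[where z = "\<one>'"]) (simp_all add: relmult_ident)
  moreover have "e ;; e\<^sup>\<smile> \<preceq> \<one>' ;; e\<^sup>\<smile>"
    using assms by (intro relmult_mono_left) simp_all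
  ultimately have "e \<preceq> e\<^sup>\<smile>"
    using assms by (metis le_trans conv_closed ident_relmult relmult_closed)
  then show ?thesis
    using assms by (metis conv_closed conv_conv conv_mono le_antisym)
qed

lemma subident_le_square:
  assumes "e \<preceq> \<one>'" "e \<in> carrier A"
  shows "e \<preceq> e ;; e"
  using subident_le_domain[of e e "\<one>'"] assms by (simp add: relmult_ident subident_conv)

lemma subident_le_relmult:
  assumes "e \<preceq> x" "e \<preceq> y" "e \<preceq> \<one>'" "e \<in> carrier A" "x \<in> carrier A" "y \<in> carrier A"
  shows "e \<preceq> x ;; y"
  using assms by (meson le_trans relmult_closed relmult_mono2 subident_le_square)

text \<open>As \<open>p\<^sup>\<smile> ;; p\<close> is below the identity,
  \<open>p\<^sup>\<smile>\<close> carries \<open>p ;; b\<close> back into \<open>b\<close>; the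
  modular law then gives the inequality that monotonicity does not provide.\<close>

lemma functional_relmult_meet:
  assumes "functional A p" "p \<in> carrier A" "a \<in> carrier A" "b \<in> carrier A"
  shows "p ;; (a \<sqdot> b) = (p ;; a) \<sqdot> (p ;; b)"
proof (rule le_antisym)
  show "p ;; (a \<sqdot> b) \<preceq> (p ;; a) \<sqdot> (p ;; b)"
    using assms by (simp add: le_meet_iff relmult_mono_right)
  have "p\<^sup>\<smile> ;; (p ;; b) \<preceq> b"
    using relmult_mono_left[of "p\<^sup>\<smile> ;; p" "\<one>'" b] assms
    by (simp add: functional_def relmult_assoc)
  then have "a \<sqdot> (p\<^sup>\<smile> ;; (p ;; b)) \<preceq> a \<sqdot> b"
    using assms meet_mono_left[of "p\<^sup>\<smile> ;; (p ;; b)" b a] by (simp add: meet_comm)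
  then have "p ;; (a \<sqdot> (p\<^sup>\<smile> ;; (p ;; b))) \<preceq> p ;; (a \<sqdot> b)"
    using assms by (intro relmult_mono_right) simp_all
  then show "(p ;; a) \<sqdot> (p ;; b) \<preceq> p ;; (a \<sqdot> b)"
    using modular[of p a "p ;; b"] assms
    by (meson le_trans meet_closed conv_closed relmult_closed)
qed (use assms in simp_all)

lemma meet_relmult_conv_functional:
  assumes "functional A q" "q \<in> carrier A" "a \<in> carrier A" "b \<in> carrier A"
  shows "(a \<sqdot> b) ;; q\<^sup>\<smile> = (a ;; q\<^sup>\<smile>) \<sqdot> (b ;; q\<^sup>\<smile>)"
proof -
  have "(q ;; (a\<^sup>\<smile> \<sqdot> b\<^sup>\<smile>))\<^sup>\<smile> = ((q ;; a\<^sup>\<smile>) \<sqdot> (q ;; b\<^sup>\<smile>))\<^sup>\<smile>"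
    using assms by (simp add: functional_relmult_meet)
  then show ?thesis using assms by (simp add: conv_relmult conv_meet conv_conv)
qed

lemma functional_relmult:
  assumes "functional A p" "functional A q" "p \<in> carrier A" "q \<in> carrier A"
  shows "functional A (p ;; q)"
proof -
  have "(p ;; q)\<^sup>\<smile> ;; (p ;; q) = q\<^sup>\<smile> ;; (p\<^sup>\<smile> ;; p) ;; q"
    using assms by (simp add: conv_relmult relmult_assoc)
  moreover have "q\<^sup>\<smile> ;; (p\<^sup>\<smile> ;; p) ;; q \<preceq> q\<^sup>\<smile> ;; \<one>' ;; q"
    using assms by (intro relmult_mono2) (simp_all add: functional_def)
  ultimately show ?thesis
    using assms le_trans[of "(p ;; q)\<^sup>\<smile> ;; (p ;; q)" "q\<^sup>\<smile> ;; q" "\<one>'"]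
    by (simp add: functional_def relmult_ident)
qed

text \<open>For functional \<open>p\<close> and \<open>q\<close>, \<open>pull p a q\<close> relates \<open>x\<close> to \<open>y\<close> if \<open>a\<close> relates \<open>p x\<close> to \<open>q y\<close>.\<close>

definition pull :: "'a \<Rightarrow> 'a \<Rightarrow> 'a \<Rightarrow> 'a" where
  "pull p a q = p ;; a ;; q\<^sup>\<smile>"

lemma pull_closed [simp, intro]:
  "\<lbrakk>p \<in> carrier A; a \<in> carrier A; q \<in> carrier A\<rbrakk> \<Longrightarrow> pull p a q \<in> carrier A"
  by (simp add: pull_def)

lemma pull_mono:
  "\<lbrakk>a \<preceq> b; p \<in> carrier A; a \<in> carrier A; b \<in> carrier A; q \<in> carrier A\<rbrakk>
    \<Longrightarrow> pull p a q \<preceq> pull p b q"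
  by (simp add: pull_def relmult_mono_left relmult_mono_right)

lemma pull_zero [simp]: "\<lbrakk>p \<in> carrier A; q \<in> carrier A\<rbrakk> \<Longrightarrow> pull p \<zero> q = \<zero>"
  by (simp add: pull_def relmult_zero)

lemma pull_ident: "p \<in> carrier A \<Longrightarrow> pull p \<one>' q = p ;; q\<^sup>\<smile>"
  by (simp add: pull_def relmult_ident)

lemma pull_meet:
  "\<lbrakk>functional A p; functional A q; p \<in> carrier A; q \<in> carrier A; a \<in> carrier A; b \<in> carrier A\<rbrakk>
    \<Longrightarrow> pull p (a \<sqdot> b) q = pull p a q \<sqdot> pull p b q"
  by (simp add: pull_def functional_relmult_meet meet_relmult_conv_functional)

lemma pull_conv:
  "\<lbrakk>p \<in> carrier A; a \<in> carrier A; q \<in> carrier A\<rbrakk> \<Longrightarrow> (pull p a q)\<^sup>\<smile> = pull q (a\<^sup>\<smile>) p"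
  by (simp add: pull_def conv_relmult conv_conv relmult_assoc)

lemma pull_pull:
  "\<lbrakk>s \<in> carrier A; p \<in> carrier A; a \<in> carrier A; q \<in> carrier A\<rbrakk>
    \<Longrightarrow> pull s (pull p a q) s = pull (s ;; p) a (s ;; q)"
  by (simp add: pull_def conv_relmult relmult_assoc)

text \<open>The inner \<open>q\<^sup>\<smile> ;; q\<close> collapses to the identity. Only an
  inclusion can be expected, as a midpoint for \<open>a ;; b\<close> need not be a value of
  \<open>q\<close>; \<open>stage_extend\<close> supplies suitable midpoints.\<close>

lemma pull_relmult_le:
  assumes "functional A q" "p \<in> carrier A" "q \<in> carrier A" "r \<in> carrier A"
    "a \<in> carrier A" "b \<in> carrier A"
  shows "pull p a q ;; pull q b r \<preceq> pull p (a ;; b) r"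
proof -
  have "pull p a q ;; pull q b r = p ;; (a ;; ((q\<^sup>\<smile> ;; q) ;; b)) ;; r\<^sup>\<smile>"
    using assms by (simp add: pull_def relmult_assoc)
  moreover have "a ;; ((q\<^sup>\<smile> ;; q) ;; b) \<preceq> a ;; (\<one>' ;; b)"
    using assms by (intro relmult_mono_right relmult_mono_left) (simp_all add: functional_def)
  ultimately show ?thesis
    using assms pull_mono[of "a ;; ((q\<^sup>\<smile> ;; q) ;; b)" "a ;; b" p r] by (simp add: pull_def)
qed

text \<open>For functional \<open>s\<close> and \<open>t\<close>, the meet in the conclusion is the
  set of \<open>z\<close> for which \<open>w\<close> relates \<open>s z\<close> to
  \<open>t z\<close>. Two Schroeder steps turn its vanishing into that of
  \<open>(s\<^sup>\<smile> ;; t) \<sqdot> w\<close>.\<close>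

lemma pull_meet_ident_nonzero:
  assumes "(s\<^sup>\<smile> ;; t) \<sqdot> w \<noteq> \<zero>" "s \<in> carrier A" "t \<in> carrier A" "w \<in> carrier A"
  shows "pull s w t \<sqdot> \<one>' \<noteq> \<zero>"
proof
  assume "pull s w t \<sqdot> \<one>' = \<zero>"
  then have "(s ;; w ;; t\<^sup>\<smile>) \<sqdot> \<one>' = \<zero>" by (simp add: pull_def)
  then have "t \<sqdot> (s ;; w) = \<zero>"
    using assms schroeder_right[of "s ;; w" "t\<^sup>\<smile>" "\<one>'"] by (simp add: conv_conv)
  then show False
    using assms schroeder_left[of s w t] by (simp add: meet_comm)
qed

end

subsection \<open>Stages\<close>

text \<open>\<open>Via a b c d\<close> names an intermediate point through which \<open>a ;; b\<close> relates \<open>c\<close> to \<open>d\<close>.\<close>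

datatype 'a wit = Start | Via 'a 'a "'a wit" "'a wit"

context J_algebra
begin

text \<open>
  A stage consists of a nonzero subidentity \<open>e\<close>, thought of as a set of generic points, and of
  functional elements \<open>f c\<close> defined on all of \<open>e\<close>. The statement that \<open>a\<close> relates \<open>c\<close> to \<open>d\<close>
  holds at the stage if \<open>e\<close> is below \<open>pull (f c) a (f d)\<close>, and is refuted if \<open>e\<close> is disjoint
  from it.
\<close>

definition sat :: "'a \<Rightarrow> ('c \<Rightarrow> 'a) \<Rightarrow> 'a \<Rightarrow> 'c \<Rightarrow> 'c \<Rightarrow> bool" where
  "sat e f a c d \<longleftrightarrow> e \<preceq> pull (f c) a (f d)"

definition refuted :: "'a \<Rightarrow> ('c \<Rightarrow> 'a) \<Rightarrow> 'a \<Rightarrow> 'c \<Rightarrow> 'c \<Rightarrow> bool" where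
  "refuted e f a c d \<longleftrightarrow> e \<sqdot> pull (f c) a (f d) = \<zero>"

text \<open>Totality of \<open>f c\<close> on \<open>e\<close> is encoded by
  \<open>sat e f \<one>' c c\<close>, which unfolds to \<open>e\<close> being below
  \<open>f c ;; (f c)\<^sup>\<smile>\<close>.\<close>

definition assignment :: "'c set \<Rightarrow> 'a \<Rightarrow> ('c \<Rightarrow> 'a) \<Rightarrow> bool" where
  "assignment D e f \<longleftrightarrow> e \<in> carrier A \<and> e \<preceq> \<one>' \<and> e \<noteq> \<zero> \<and>
     (\<forall>c\<in>D. f c \<in> carrier A \<and> functional A (f c) \<and> sat e f \<one>' c c)"

text \<open>Each named midpoint in \<open>D\<close> must already do its work unless the composite is
  refuted. Membership in the carrier is a guard because \<open>wit\<close> also contains terms built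
  from elements outside the algebra. The clause on \<open>g\<close> is what forces a prescribed
  element to be nonempty in the limit.\<close>

definition stage :: "'a \<Rightarrow> 'a wit set \<Rightarrow> 'a \<Rightarrow> ('a wit \<Rightarrow> 'a) \<Rightarrow> bool" where
  "stage g D e f \<longleftrightarrow> assignment D e f \<and> Start \<in> D \<and> sat e f g Start Start \<and>
     (\<forall>a b c d. Via a b c d \<in> D \<longrightarrow> a \<in> carrier A \<longrightarrow> b \<in> carrier A \<longrightarrow> c \<in> D \<and> d \<in> D \<and>
        (refuted e f (a ;; b) c d \<or> sat e f a c (Via a b c d) \<and> sat e f b (Via a b c d) d))"

context
  fixes D e f
  assumes asg: "assignment D e f"
begin

lemma assignmentD:
  "e \<in> carrier A" "e \<preceq> \<one>'" "e \<noteq> \<zero>"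
  "c \<in> D \<Longrightarrow> f c \<in> carrier A" "c \<in> D \<Longrightarrow> functional A (f c)" "c \<in> D \<Longrightarrow> sat e f \<one>' c c"
  using asg by (auto simp: assignment_def)

lemma sat_not_refuted:
  "\<lbrakk>sat e f a c d; refuted e f a c d\<rbrakk> \<Longrightarrow> False"
  using assignmentD(3) by (simp add: sat_def refuted_def leq_def)

lemma not_sat_zero: "\<lbrakk>c \<in> D; d \<in> D\<rbrakk> \<Longrightarrow> \<not> sat e f \<zero> c d"
  using assignmentD le_zero by (auto simp: sat_def)

lemma sat_meet:
  "\<lbrakk>c \<in> D; d \<in> D; a \<in> carrier A; b \<in> carrier A\<rbrakk>
    \<Longrightarrow> sat e f (a \<sqdot> b) c d \<longleftrightarrow> sat e f a c d \<and> sat e f b c d"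
  by (simp add: sat_def assignmentD pull_meet le_meet_iff)

lemma sat_conv:
  assumes "sat e f a c d" "c \<in> D" "d \<in> D" "a \<in> carrier A"
  shows "sat e f (a\<^sup>\<smile>) d c"
proof -
  have "e\<^sup>\<smile> \<preceq> (pull (f c) a (f d))\<^sup>\<smile>"
    using assms by (intro conv_mono) (simp_all add: sat_def assignmentD)
  then show ?thesis
    using assms by (simp add: sat_def assignmentD pull_conv subident_conv)
qed

lemma sat_relmult:
  assumes "sat e f a c k" "sat e f b k d" "c \<in> D" "k \<in> D" "d \<in> D" "a \<in> carrier A" "b \<in> carrier A"
  shows "sat e f (a ;; b) c d"
proof -
  have "e \<preceq> pull (f c) a (f k) ;; pull (f k) b (f d)"
    using assms by (intro subident_le_relmult) (simp_all add: sat_def assignmentD)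
  moreover have "\<dots> \<preceq> pull (f c) (a ;; b) (f d)"
    using assms by (intro pull_relmult_le) (simp_all add: assignmentD)
  ultimately show ?thesis
    unfolding sat_def using assms by (meson assignmentD le_trans pull_closed relmult_closed)
qed

text \<open>By totality \<open>e\<close> lies below the product of the domains of \<open>f c\<close>
  and \<open>f d\<close>; regrouped, this product is a pull of
  \<open>(f c)\<^sup>\<smile> ;; f d\<close>, which is enlarged to the unit.\<close>

lemma sat_unit:
  assumes "c \<in> D" "d \<in> D"
  shows "sat e f \<one> c d"
proof -
  have "e \<preceq> pull (f c) \<one>' (f c) ;; pull (f d) \<one>' (f d)"
    using assms assignmentD(6) by (intro subident_le_relmult) (simp_all add: sat_def assignmentD)
  moreover have "\<dots> = pull (f c) ((f c)\<^sup>\<smile> ;; f d) (f d)"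
    using assms by (simp add: pull_def assignmentD relmult_assoc relmult_ident)
  moreover have "\<dots> \<preceq> pull (f c) \<one> (f d)"
    using assms by (intro pull_mono) (simp_all add: assignmentD)
  ultimately show ?thesis
    unfolding sat_def using assms
    by (metis (no_types, lifting) assignmentD(1,4) conv_closed le_trans pull_closed relmult_closed unit_closed)
qed

end

text \<open>For a subidentity \<open>e'\<close> and functional \<open>s\<close>, being below
  \<open>pull s e s\<close> means that \<open>s\<close> is defined on \<open>e'\<close> with values
  in \<open>e\<close>. Precomposition with \<open>s\<close> then preserves what holds throughout
  \<open>e\<close>.\<close>

lemma sat_refine:
  assumes "assignment D e f" "sat e f a c d" "c \<in> D" "d \<in> D" "a \<in> carrier A"
    and "s \<in> carrier A" "e' \<in> carrier A" "e' \<preceq> pull s e s"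
    and "f' c = s ;; f c" "f' d = s ;; f d"
  shows "sat e' f' a c d"
proof -
  note asg = assignmentD[OF assms(1)]
  have "pull s e s \<preceq> pull s (pull (f c) a (f d)) s"
    using assms asg by (intro pull_mono) (simp_all add: sat_def)
  then have "e' \<preceq> pull s (pull (f c) a (f d)) s"
    using assms asg by (meson le_trans pull_closed)
  then show ?thesis
    unfolding sat_def using assms asg by (simp add: pull_pull)
qed

text \<open>Functionality of \<open>s\<close> enters here: it makes pulling along \<open>s\<close>
  preserve meets, and hence disjointness.\<close>

lemma refuted_refine:
  assumes "assignment D e f" "refuted e f a c d" "c \<in> D" "d \<in> D" "a \<in> carrier A"
    and "functional A s" "s \<in> carrier A" "e' \<in> carrier A" "e' \<preceq> pull s e s"
    and "f' c = s ;; f c" "f' d = s ;; f d"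
  shows "refuted e' f' a c d"
proof -
  note asg = assignmentD[OF assms(1)]
  let ?y = "pull (f c) a (f d)"
  have "pull s e s \<sqdot> pull s ?y s = \<zero>"
    using assms asg pull_meet[of s s e ?y] by (simp add: refuted_def)
  then have "e' \<sqdot> pull s ?y s = \<zero>"
    using assms(3-5,7,8) asg(1,4) by (intro disjoint_mono[OF assms(9)]) simp_all
  then show ?thesis
    unfolding refuted_def using assms(3-5,7,10,11) asg(4) by (simp add: pull_pull)
qed

lemma stage_shrink:
  assumes st: "stage g D e f" and g: "g \<in> carrier A"
    and e': "e' \<in> carrier A" "e' \<preceq> e" "e' \<noteq> \<zero>"
  shows "stage g D e' f"
proof -
  have asg: "assignment D e f" using st by (simp add: stage_def)
  note asgD = assignmentD[OF asg]
  have sat': "sat e' f a c d" if "sat e f a c d" "c \<in> D" "d \<in> D" "a \<in> carrier A" for a c d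
    using that e' asgD unfolding sat_def by (meson le_trans pull_closed)
  have ref': "refuted e' f a c d" if "refuted e f a c d" "c \<in> D" "d \<in> D" "a \<in> carrier A" for a c d
    using that e' asgD unfolding refuted_def by (meson disjoint_mono pull_closed)
  have "assignment D e' f"
    using e' asgD sat' le_trans[of e' e "\<one>'"] by (auto simp: assignment_def)
  then show ?thesis
    using st sat' ref' g unfolding stage_def by (metis relmult_closed)
qed

text \<open>An unrefuted statement cuts out a nonzero part of \<open>e\<close>, and on this part it
  is satisfied.\<close>

lemma stage_decide:
  assumes st: "stage g D e f" and g: "g \<in> carrier A" and "c \<in> D" "d \<in> D" "a \<in> carrier A"
  obtains e' where "e' \<in> carrier A" "e' \<preceq> e" "stage g D e' f" "sat e' f a c d \<or> refuted e' f a c d"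
proof (cases "refuted e f a c d")
  case True
  have "e \<in> carrier A" using st by (auto simp: stage_def assignment_def)
  then show ?thesis using that[of e] st True by simp
next
  case False
  have asg: "assignment D e f" using st by (simp add: stage_def)
  let ?e' = "e \<sqdot> pull (f c) a (f d)"
  have "stage g D ?e' f"
    using assms False assignmentD[OF asg] by (intro stage_shrink[OF st g]) (simp_all add: refuted_def)
  then show ?thesis
    using that[of ?e'] assms assignmentD[OF asg] by (simp add: sat_def)
qed

lemma stage_decide_finite:
  assumes "finite S" "stage g D e f" "g \<in> carrier A"
    and "\<And>a c d. (a, c, d) \<in> S \<Longrightarrow> a \<in> carrier A \<and> c \<in> D \<and> d \<in> D"
  shows "\<exists>e'. stage g D e' f \<and> (\<forall>(a, c, d)\<in>S. sat e' f a c d \<or> refuted e' f a c d)"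
  using assms(1,4)
proof (induction S rule: finite_induct)
  case empty
  then show ?case using assms(2) by auto
next
  case (insert x S)
  obtain e1 where e1: "stage g D e1 f" "\<forall>(a, c, d)\<in>S. sat e1 f a c d \<or> refuted e1 f a c d"
    using insert by blast
  obtain a c d where x: "x = (a, c, d)" by (cases x)
  then have acd: "a \<in> carrier A" "c \<in> D" "d \<in> D" using insert.prems by auto
  obtain e2 where e2: "e2 \<in> carrier A" "e2 \<preceq> e1" "stage g D e2 f"
      "sat e2 f a c d \<or> refuted e2 f a c d"
    using stage_decide[OF e1(1) assms(3) acd(2,3,1)] by metis
  have asg: "assignment D e1 f" using e1 by (simp add: stage_def)
  note asgD = assignmentD[OF asg]
  \<comment> \<open>Earlier decisions survive, since satisfaction and refutation both pass to
    smaller subidentities.\<close>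
  have "sat e2 f a c d \<or> refuted e2 f a c d" if "(a, c, d) \<in> S" for a c d
  proof -
    have acd: "a \<in> carrier A" "c \<in> D" "d \<in> D" using insert.prems that by auto
    have P: "pull (f c) a (f d) \<in> carrier A" using acd asgD by simp
    have "sat e1 f a c d \<or> refuted e1 f a c d" using e1 that by auto
    then show ?thesis
      unfolding sat_def refuted_def using P e2(1,2) asgD(1)
      by (meson disjoint_mono le_trans)
  qed
  then show ?case using e2 x by (intro exI[of _ e2]) auto
qed

end

subsection \<open>From finite consistency to models\<close>

text \<open>Compactness for truth assignments. Zorn's lemma gives a maximal set \<open>M\<close> of
  literals \<open>(s, b)\<close> whose finite parts are realised in every \<open>G S\<close> with
  \<open>S\<close> finite. Maximality decides each statement, so \<open>M\<close> is read off as a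
  valuation.\<close>

lemma finitely_consistent_valuation:
  fixes G :: "'s set \<Rightarrow> ('s \<Rightarrow> bool) set"
  assumes ne: "\<And>S. finite S \<Longrightarrow> G S \<noteq> {}"
    and anti: "\<And>S T. \<lbrakk>S \<subseteq> T; finite T\<rbrakk> \<Longrightarrow> G T \<subseteq> G S"
  shows "\<exists>V. \<forall>S. finite S \<longrightarrow> (\<exists>v\<in>G S. \<forall>s\<in>S. v s = V s)"
proof -
  define Q where "Q = {M. \<forall>S L. finite S \<longrightarrow> finite L \<longrightarrow> L \<subseteq> M \<longrightarrow> (\<exists>v\<in>G S. \<forall>(s, b)\<in>L. v s = b)}"
  have "\<exists>M\<in>Q. \<forall>X\<in>Q. M \<subseteq> X \<longrightarrow> X = M"
  proof (rule subset_Zorn')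
    fix C assume C: "subset.chain Q C"
    show "\<Union>C \<in> Q"
      unfolding Q_def
    proof (intro CollectI allI impI)
      fix S :: "'s set" and L assume fin: "finite S" "finite L" and L: "L \<subseteq> \<Union>C"
      show "\<exists>v\<in>G S. \<forall>(s, b)\<in>L. v s = b"
      \<comment> \<open>For the empty chain \<open>L\<close> is empty and any member of
        \<open>G S\<close> will do; otherwise the finite set \<open>L\<close> lies in a single
        member of the chain.\<close>
      proof (cases "C = {}")
        case True
        then show ?thesis using L ne[OF fin(1)] by auto
      next
        case False
        then obtain M where "M \<in> C" "L \<subseteq> M"
          using finite_subset_Union_chain[OF fin(2) L _ C] by blast
        moreover have "M \<in> Q" using C \<open>M \<in> C\<close> by (auto simp: subset.chain_def)
        ultimately show ?thesis using fin unfolding Q_def by blast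
      qed
    qed
  qed
  then obtain M where M: "M \<in> Q" and max: "\<And>X. \<lbrakk>X \<in> Q; M \<subseteq> X\<rbrakk> \<Longrightarrow> X = M" by blast
  have fin_sat: "\<exists>v\<in>G S. \<forall>(s, b)\<in>L. v s = b" if "finite S" "finite L" "L \<subseteq> M" for S L
    using M that unfolding Q_def by simp
  have total: "(s, True) \<in> M \<or> (s, False) \<in> M" for s
  proof (rule ccontr)
    assume neg: "\<not> ((s, True) \<in> M \<or> (s, False) \<in> M)"
    \<comment> \<open>If \<open>(s, b)\<close> cannot be added, a finite obstruction shows this.
      With \<open>(s, b)\<close> removed from it, the remaining literals belong to \<open>M\<close>
      and force the opposite value at \<open>s\<close>.\<close>
    have "\<exists>S L. finite S \<and> finite L \<and> L \<subseteq> M \<and> (\<forall>v\<in>G S. (\<forall>(t, b)\<in>L. v t = b) \<longrightarrow> v s = (\<not> b))" for b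
    proof -
      have "insert (s, b) M \<notin> Q" using max[of "insert (s, b) M"] neg by (cases b) auto
      then obtain S L where SL: "finite S" "finite L" "L \<subseteq> insert (s, b) M"
        "\<not> (\<exists>v\<in>G S. \<forall>(t, b)\<in>L. v t = b)" unfolding Q_def by blast
      have "v s = (\<not> b)" if v: "v \<in> G S" "\<forall>(t, b)\<in>L - {(s, b)}. v t = b" for v
      proof (rule ccontr)
        assume "v s \<noteq> (\<not> b)"
        then have "\<forall>(t, b)\<in>L. v t = b" using v(2) by blast
        then show False using SL(4) v(1) by blast
      qed
      moreover have "finite (L - {(s, b)})" "L - {(s, b)} \<subseteq> M" using SL by auto
      ultimately show ?thesis using SL(1) by blast
    qed
    then obtain S L where SL: "\<And>b. finite (S b)" "\<And>b. finite (L b)" "\<And>b. L b \<subseteq> M"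
      "\<And>b v. \<lbrakk>v \<in> G (S b); \<forall>(t, b)\<in>L b. v t = b\<rbrakk> \<Longrightarrow> v s = (\<not> b)" by metis
    have fin: "finite (S True \<union> S False)" "finite (L True \<union> L False)" "L True \<union> L False \<subseteq> M"
      using SL by auto
    then obtain v where v: "v \<in> G (S True \<union> S False)" "\<forall>(t, b)\<in>L True \<union> L False. v t = b"
      using fin_sat by metis
    \<comment> \<open>A valuation for both obstructions at once exists by finite realisability;
      antitonicity of \<open>G\<close> makes it obey each of them, so it must take both values at
      \<open>s\<close>.\<close>
    have "S b \<subseteq> S True \<union> S False" "L b \<subseteq> L True \<union> L False" for b by (cases b; auto)+
    then have "v s = (\<not> b)" for b
      using SL(4)[of v b] v anti[OF _ fin(1), of "S b"] by blast
    then show False by blast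
  qed
  define V where "V s \<longleftrightarrow> (s, True) \<in> M" for s
  show ?thesis
  proof (intro exI[of _ V] allI impI)
    fix S :: "'s set" assume "finite S"
    moreover have "(s, V s) \<in> M" for s using total by (cases "V s") (auto simp: V_def)
    then have "(\<lambda>s. (s, V s)) ` S \<subseteq> M" by blast
    ultimately have "\<exists>v\<in>G S. \<forall>(s, b)\<in>(\<lambda>s. (s, V s)) ` S. v s = b"
      by (intro fin_sat) simp_all
    then show "\<exists>v\<in>G S. \<forall>s\<in>S. v s = V s" by auto
  qed
qed

text \<open>These are the clauses of a homomorphism into relations, except that
  \<open>\<one>'\<close> is only required to be reflexive. That it is a congruence follows from the
  other clauses in \<open>model_ident\<close>; equality is restored by passing to
  representatives.\<close>

definition model :: "('a, 'm) J_sig_scheme \<Rightarrow> ('a \<Rightarrow> 'c \<Rightarrow> 'c \<Rightarrow> bool) \<Rightarrow> bool" where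
  "model A V \<longleftrightarrow>
     (\<forall>c d. \<not> V \<zero>\<^bsub>A\<^esub> c d \<and> V \<one>\<^bsub>A\<^esub> c d) \<and> (\<forall>c. V \<one>'\<^bsub>A\<^esub> c c) \<and>
     (\<forall>a\<in>carrier A. \<forall>c d. V (a\<^sup>\<smile>\<^bsub>A\<^esub>) c d \<longleftrightarrow> V a d c) \<and>
     (\<forall>a\<in>carrier A. \<forall>b\<in>carrier A. \<forall>c d.
        (V (a \<sqdot>\<^bsub>A\<^esub> b) c d \<longleftrightarrow> V a c d \<and> V b c d) \<and>
        (V (a ;;\<^bsub>A\<^esub> b) c d \<longleftrightarrow> (\<exists>k. V a c k \<and> V b k d)))"

lemma modelD:
  assumes "model A V"
  shows "\<not> V \<zero>\<^bsub>A\<^esub> c d" and "V \<one>\<^bsub>A\<^esub> c d" and "V \<one>'\<^bsub>A\<^esub> c c"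
    and "a \<in> carrier A \<Longrightarrow> V (a\<^sup>\<smile>\<^bsub>A\<^esub>) c d \<longleftrightarrow> V a d c"
    and "\<lbrakk>a \<in> carrier A; b \<in> carrier A\<rbrakk> \<Longrightarrow> V (a \<sqdot>\<^bsub>A\<^esub> b) c d \<longleftrightarrow> V a c d \<and> V b c d"
    and "\<lbrakk>a \<in> carrier A; b \<in> carrier A\<rbrakk> \<Longrightarrow> V (a ;;\<^bsub>A\<^esub> b) c d \<longleftrightarrow> (\<exists>k. V a c k \<and> V b k d)"
  using assms unfolding model_def by simp_all

section \<open>Extension of stages by intermediate points\<close>

context J_algebra
begin

text \<open>The bookkeeping shared by both cases of \<open>stage_extend\<close>: old points are
  precomposed with \<open>s\<close>, the new point is \<open>t\<close>, and old requirements survive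
  by \<open>sat_refine\<close> and \<open>refuted_refine\<close>. Only the requirement on
  \<open>k\<close> itself is left to the caller.\<close>

lemma stage_update:
  assumes st: "stage g D e f" and g: "g \<in> carrier A" and k: "k = Via a b c d" "k \<notin> D"
    and cd: "c \<in> D" "d \<in> D"
    and s: "s \<in> carrier A" "functional A s" and t: "t \<in> carrier A" "functional A t"
    and e': "e' \<in> carrier A" "e' \<preceq> \<one>'" "e' \<noteq> \<zero>" "e' \<preceq> pull s e s" "e' \<preceq> pull t \<one>' t"
    and f': "f' = (\<lambda>x. if x = k then t else s ;; f x)"
    and k_ok: "\<lbrakk>a \<in> carrier A; b \<in> carrier A\<rbrakk> \<Longrightarrow>
      refuted e' f' (a ;; b) c d \<or> sat e' f' a c k \<and> sat e' f' b k d"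
  shows "stage g (insert k D) e' f'"
proof -
  have asg: "assignment D e f" using st by (simp add: stage_def)
  note asgD = assignmentD[OF asg]
  have f'D: "f' x = s ;; f x" if "x \<in> D" for x using that k f' by auto
  have f'k: "f' k = t" by (simp add: f')
  have sat': "sat e' f' x y z" if "sat e f x y z" "y \<in> D" "z \<in> D" "x \<in> carrier A" for x y z
    using sat_refine[OF asg that s(1) e'(1,4) f'D[OF that(2)] f'D[OF that(3)]] .
  have ref': "refuted e' f' x y z" if "refuted e f x y z" "y \<in> D" "z \<in> D" "x \<in> carrier A" for x y z
    using refuted_refine[OF asg that s(2,1) e'(1,4) f'D[OF that(2)] f'D[OF that(3)]] .
  have "f' x \<in> carrier A \<and> functional A (f' x) \<and> sat e' f' \<one>' x x" if "x \<in> insert k D" for x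
  proof (cases "x = k")
    case True
    then show ?thesis using t e' by (simp add: f'k sat_def)
  next
    case False
    then have "x \<in> D" using that by simp
    then show ?thesis using asgD(4-6)[OF \<open>x \<in> D\<close>] s sat'[of "\<one>'" x x]
      by (simp add: f'D functional_relmult)
  qed
  then have "assignment (insert k D) e' f'"
    using e' by (simp add: assignment_def)
  moreover have start: "Start \<in> D" "sat e f g Start Start"
    using st unfolding stage_def by blast+
  moreover have "sat e' f' g Start Start"
    using sat'[OF start(2,1,1) g] .
  moreover have "x \<in> insert k D \<and> y \<in> insert k D \<and>
      (refuted e' f' (p ;; q) x y \<or> sat e' f' p x (Via p q x y) \<and> sat e' f' q (Via p q x y) y)"
    if V: "Via p q x y \<in> insert k D" and pq: "p \<in> carrier A" "q \<in> carrier A" for p q x y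
  proof (cases "Via p q x y = k")
    case True
    then show ?thesis using k cd k_ok pq by auto
  next
    case False
    then have VD: "Via p q x y \<in> D" using V by simp
    then have "x \<in> D" "y \<in> D"
      "refuted e f (p ;; q) x y \<or> sat e f p x (Via p q x y) \<and> sat e f q (Via p q x y) y"
      using st pq unfolding stage_def by blast+
    then show ?thesis using sat' ref' VD pq by blast
  qed
  ultimately show ?thesis unfolding stage_def by blast
qed

lemma functional_ident [simp]: "functional A \<one>'"
  by (simp add: functional_def)

lemma tabular_nonzero:
  assumes "tabular A" "w \<in> carrier A" "w \<noteq> \<zero>"
  obtains s t where "s \<in> carrier A" "t \<in> carrier A" "functional A s" "functional A t"
    "s\<^sup>\<smile> ;; t \<noteq> \<zero>" "s\<^sup>\<smile> ;; t \<preceq> w"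
proof -
  have "lt A \<zero> w" using assms by (auto simp: lt_def)
  then have "\<exists>p\<in>carrier A. \<exists>q\<in>carrier A. functional A p \<and> functional A q \<and> \<zero> \<noteq> p\<^sup>\<smile> ;; q \<and>
      p\<^sup>\<smile> ;; q \<preceq> w"
    using assms unfolding tabular_def by (meson zero_closed)
  then show ?thesis using that by metis
qed

text \<open>Decide \<open>a ;; b\<close> first. If it is refuted, any point may be added. Otherwise
  tabularity finds a nonzero \<open>s\<^sup>\<smile> ;; t\<close> inside the relation between a
  generic point and its possible midpoints; a new generic point \<open>z\<close> then stands for the
  old point \<open>s z\<close> with midpoint \<open>t z\<close>.\<close>

lemma stage_extend:
  assumes tab: "tabular A" and st: "stage g D e f" and g: "g \<in> carrier A"
    and cd: "c \<in> D" "d \<in> D"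
  shows "\<exists>e' f'. stage g (insert (Via a b c d) D) e' f'"
proof (cases "Via a b c d \<in> D")
  case True
  then show ?thesis using st by (auto simp: insert_absorb)
next
  case kD: False
  define k where "k = Via a b c d"
  have kD: "k \<notin> D" using kD by (simp add: k_def)
  \<comment> \<open>The added point carries no obligation here, so it may copy \<open>f c\<close>,
    which is total on \<open>e\<close>; taking \<open>\<one>'\<close> for \<open>s\<close> leaves
    the other points unchanged.\<close>
  have trivial: "\<exists>e' f'. stage g (insert k D) e' f'"
    if st: "stage g D e f" and r: "\<lbrakk>a \<in> carrier A; b \<in> carrier A\<rbrakk> \<Longrightarrow> refuted e f (a ;; b) c d" for e
  proof -
    have asg: "assignment D e f" using st by (simp add: stage_def)
    note asgD = assignmentD[OF asg]
    let ?f' = "\<lambda>x. if x = k then f c else \<one>' ;; f x"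
    have e: "e \<preceq> pull \<one>' e \<one>'" using asgD by (simp add: pull_def relmult_ident)
    have "c \<noteq> k" "d \<noteq> k" using cd kD by auto
    then have "refuted e ?f' (a ;; b) c d" if "a \<in> carrier A" "b \<in> carrier A"
      using refuted_refine[OF asg r[OF that] cd _ functional_ident ident_closed asgD(1) e, of ?f']
        that by simp
    then have "stage g (insert k D) e ?f'"
      using asgD cd asgD(6)[OF cd(1)] e
      by (intro stage_update[OF st g k_def kD cd ident_closed functional_ident
            asgD(4)[OF cd(1)] asgD(5)[OF cd(1)]]) (auto simp: sat_def)
    then show ?thesis by blast
  qed
  show ?thesis
  proof (cases "a \<in> carrier A \<and> b \<in> carrier A")
    case False
    then show ?thesis using trivial[OF st] by (auto simp: k_def)
  next
    case True
    then have ab: "a \<in> carrier A" "b \<in> carrier A" by auto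
    obtain e1 where e1: "stage g D e1 f" "sat e1 f (a ;; b) c d \<or> refuted e1 f (a ;; b) c d"
      using stage_decide[OF st g cd, of "a ;; b"] ab by (metis relmult_closed)
    show ?thesis
    proof (cases "refuted e1 f (a ;; b) c d")
      case True
      then show ?thesis using trivial[OF e1(1)] by (simp add: k_def)
    next
      case False
      have asg: "assignment D e1 f" using e1 by (simp add: stage_def)
      note e1D = assignmentD(1-3)[OF asg]
      define p q where "p = f c" and "q = f d"
      have pq: "p \<in> carrier A" "q \<in> carrier A"
        using assignmentD[OF asg] cd by (simp_all add: p_def q_def)
      note cl = ab pq e1D(1)
      have "e1 \<preceq> pull p (a ;; b) q" using e1 False by (simp add: sat_def p_def q_def)
      then have sat_ab: "e1 \<preceq> (p ;; a) ;; (b ;; q\<^sup>\<smile>)"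
        using cl by (simp add: pull_def relmult_assoc)
      \<comment> \<open>\<open>w\<close> relates \<open>x\<close> in \<open>e1\<close> to those
        \<open>y\<close> for which \<open>a\<close> relates \<open>p x\<close> to \<open>y\<close>
        and \<open>b\<close> relates \<open>y\<close> to \<open>q x\<close>: all candidates for the
        midpoint.\<close>
      define w where "w = (p ;; a) \<sqdot> (e1 ;; (q ;; b\<^sup>\<smile>))"
      have w: "w \<in> carrier A" using cl by (simp add: w_def)
      have "w \<noteq> \<zero>"
      proof
        assume "w = \<zero>"
        then have "(e1 ;; (b ;; q\<^sup>\<smile>)\<^sup>\<smile>) \<sqdot> (p ;; a) = \<zero>"
          using cl by (simp add: w_def meet_comm conv_relmult conv_conv)
        then have "((p ;; a) ;; (b ;; q\<^sup>\<smile>)) \<sqdot> e1 = \<zero>"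
          using cl schroeder_right[of "p ;; a" "b ;; q\<^sup>\<smile>" e1] by simp
        then show False using sat_ab e1D cl by (simp add: leq_def meet_comm)
      qed
      then obtain s t where st: "s \<in> carrier A" "t \<in> carrier A" "functional A s" "functional A t"
        "s\<^sup>\<smile> ;; t \<noteq> \<zero>" "s\<^sup>\<smile> ;; t \<preceq> w"
        using tabular_nonzero[OF tab w] by metis
      \<comment> \<open>The new generic points are the \<open>z\<close> for which \<open>t z\<close>
        is a midpoint over \<open>s z\<close>.\<close>
      define e' where "e' = pull s w t \<sqdot> \<one>'"
      have e': "e' \<in> carrier A" "e' \<preceq> \<one>'" "e' \<preceq> pull s w t"
        using st w by (simp_all add: e'_def)
      have "e' \<noteq> \<zero>"
        unfolding e'_def using st w by (intro pull_meet_ident_nonzero) (simp_all add: leq_def)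
      have above: "e' \<preceq> pull s x t" if "w \<preceq> x" "x \<in> carrier A" for x
        using that e' w st le_trans[OF e'(3) pull_mono[of w x s t]] by simp
      have w1: "w \<preceq> p ;; a" and w2: "w \<preceq> e1 ;; (q ;; b\<^sup>\<smile>)"
        using cl by (simp_all add: w_def)
      have "e1 ;; (q ;; b\<^sup>\<smile>) \<preceq> \<one>' ;; (q ;; b\<^sup>\<smile>)"
        using cl e1D by (intro relmult_mono_left) simp_all
      then have w3: "w \<preceq> q ;; b\<^sup>\<smile>"
        using le_trans[OF w2] cl w by simp
      \<comment> \<open>The factor \<open>e1\<close> in \<open>w\<close> ensures that
        \<open>s\<close> carries \<open>e'\<close> into \<open>e1\<close>: the domain bound gives
        \<open>(s ;; e1) ;; (s ;; e1)\<^sup>\<smile>\<close>, which is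
        \<open>pull s (e1 ;; e1) s\<close> because \<open>e1\<close> is its own converse.\<close>
      have "e' \<preceq> (s ;; e1) ;; (q ;; b\<^sup>\<smile> ;; t\<^sup>\<smile>)"
        using above[OF w2] cl st by (simp add: pull_def relmult_assoc)
      then have "e' \<preceq> (s ;; e1) ;; (s ;; e1)\<^sup>\<smile>"
        using cl st e' by (intro subident_le_domain[where z = "q ;; b\<^sup>\<smile> ;; t\<^sup>\<smile>"]) simp_all
      then have "e' \<preceq> pull s (e1 ;; e1) s"
        using cl st e1D by (simp add: pull_def conv_relmult subident_conv relmult_assoc)
      moreover have "e1 ;; e1 \<preceq> e1 ;; \<one>'"
        using cl e1D by (intro relmult_mono_right) simp_all
      ultimately have refine: "e' \<preceq> pull s e1 s"
        using le_trans[OF _ pull_mono[of "e1 ;; e1" e1 s s]] cl st e' by (simp add: relmult_ident)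
      have conv_e': "e' \<preceq> pull t (x\<^sup>\<smile>) s" if "w \<preceq> x" "x \<in> carrier A" for x
        using conv_mono[OF above[OF that]] that st e' by (simp add: subident_conv pull_conv)
      \<comment> \<open>Read in the converse direction, \<open>w\<close> shows that \<open>t\<close>
        is defined wherever \<open>e'\<close> is, so the domain bound gives totality.\<close>
      have "e' \<preceq> t ;; (w\<^sup>\<smile> ;; s\<^sup>\<smile>)"
        using conv_e'[of w] w st by (simp add: pull_def relmult_assoc)
      then have total: "e' \<preceq> pull t \<one>' t"
        using subident_le_domain[of e' t "w\<^sup>\<smile> ;; s\<^sup>\<smile>"] e' w st by (simp add: pull_ident)
      have sat1: "e' \<preceq> pull (s ;; p) a t"
        using above[OF w1] cl st by (simp add: pull_def relmult_assoc)
      have sat2: "e' \<preceq> pull t b (s ;; q)"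
        using conv_e'[OF w3] cl st by (simp add: pull_def relmult_assoc conv_relmult conv_conv)
      have "c \<noteq> k" "d \<noteq> k" using cd kD by auto
      then have "stage g (insert k D) e' (\<lambda>x. if x = k then t else s ;; f x)"
        using sat1 sat2
        by (intro stage_update[OF e1(1) g k_def kD cd st(1,3,2,4) e'(1,2) \<open>e' \<noteq> \<zero>\<close> refine total refl])
          (simp add: sat_def p_def q_def)
      then show ?thesis unfolding k_def by blast
    qed
  qed
qed

text \<open>The endpoints of a \<open>Via\<close> term must be present before the term can be added,
  whence induction on the term with the stage left arbitrary.\<close>

lemma stage_extend_term:
  assumes tab: "tabular A" and g: "g \<in> carrier A" and "stage g D e f"
  shows "\<exists>D' e' f'. stage g D' e' f' \<and> D \<subseteq> D' \<and> t \<in> D'"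
  using assms(3)
proof (induction t arbitrary: D e f)
  case Start
  then show ?case by (auto simp: stage_def)
next
  case (Via a b c d)
  obtain D1 e1 f1 where 1: "stage g D1 e1 f1" "D \<subseteq> D1" "c \<in> D1"
    using Via.IH(1)[OF Via.prems] by blast
  obtain D2 e2 f2 where 2: "stage g D2 e2 f2" "D1 \<subseteq> D2" "d \<in> D2"
    using Via.IH(2)[OF 1(1)] by blast
  obtain e3 f3 where 3: "stage g (insert (Via a b c d) D2) e3 f3"
    using stage_extend[OF tab 2(1) g, of c d a b] 1 2 by blast
  have "D \<subseteq> insert (Via a b c d) D2" using 1 2 by blast
  then show ?case using 3 by blast
qed

lemma stage_exists:
  assumes tab: "tabular A" and g: "g \<in> carrier A" "g \<preceq> \<one>'" "g \<noteq> \<zero>" and "finite T"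
  shows "\<exists>D e f. stage g D e f \<and> T \<subseteq> D"
  using \<open>finite T\<close>
proof (induction T rule: finite_induct)
  case empty
  \<comment> \<open>Initially \<open>Start\<close> is the generic point of \<open>g\<close>
    itself.\<close>
  have "stage g {Start} g (\<lambda>_. \<one>')"
    using g by (simp add: stage_def assignment_def sat_def pull_def relmult_ident)
  then show ?case by blast
next
  case (insert t T)
  then obtain D e f where "stage g D e f" "T \<subseteq> D" by blast
  then show ?case using stage_extend_term[OF tab g(1), of D e f t] by blast
qed

text \<open>Only truth values pass to the limit: the stage may change with \<open>S\<close>, and no
  limit of the subidentities or functional elements is formed. Refutation of the false statements is
  recorded because complements will need it.\<close>

definition approximable :: "'a \<Rightarrow> ('a \<Rightarrow> 'a wit \<Rightarrow> 'a wit \<Rightarrow> bool) \<Rightarrow> bool" where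
  "approximable g V \<longleftrightarrow> (\<forall>S. finite S \<longrightarrow> fst ` S \<subseteq> carrier A \<longrightarrow>
     (\<exists>D e f. stage g D e f \<and> (\<forall>(a, c, d)\<in>S. c \<in> D \<and> d \<in> D \<and>
        (V a c d \<longleftrightarrow> sat e f a c d) \<and> (V a c d \<or> refuted e f a c d))))"

lemma approximable_exists:
  assumes tab: "tabular A" and g: "g \<in> carrier A" "g \<preceq> \<one>'" "g \<noteq> \<zero>"
  shows "\<exists>V. approximable g V"
proof -
  \<comment> \<open>The truth values of a stage that decides \<open>S\<close>. Compactness runs over
    all triples of the type, hence the guard on elements outside the carrier.\<close>
  define G where "G S = {v. \<exists>D e f. stage g D e f \<and> v = (\<lambda>(a, c, d). sat e f a c d) \<and>
    (\<forall>(a, c, d)\<in>S. a \<in> carrier A \<longrightarrow> c \<in> D \<and> d \<in> D \<and> (sat e f a c d \<or> refuted e f a c d))}" for S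
  have "\<exists>V. \<forall>S. finite S \<longrightarrow> (\<exists>v\<in>G S. \<forall>s\<in>S. v s = V s)"
  proof (rule finitely_consistent_valuation)
    fix S :: "('a \<times> 'a wit \<times> 'a wit) set"
    assume "finite S"
    let ?S = "{s \<in> S. fst s \<in> carrier A}"
    let ?T = "(fst \<circ> snd) ` S \<union> (snd \<circ> snd) ` S"
    obtain D e f where D: "stage g D e f" "?T \<subseteq> D"
      using stage_exists[OF assms, of ?T] \<open>finite S\<close> by blast
    have TD: "c \<in> D" "d \<in> D" if "(a, c, d) \<in> S" for a c d
      using D(2) that by force+
    have "\<exists>e'. stage g D e' f \<and> (\<forall>(a, c, d)\<in>?S. sat e' f a c d \<or> refuted e' f a c d)"
      by (rule stage_decide_finite[OF _ D(1) g(1)]) (use \<open>finite S\<close> TD in auto)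
    then obtain e' where e': "stage g D e' f"
      and dec: "\<And>a c d. \<lbrakk>(a, c, d) \<in> S; a \<in> carrier A\<rbrakk> \<Longrightarrow> sat e' f a c d \<or> refuted e' f a c d"
      by fastforce
    have "\<forall>(a, c, d)\<in>S. a \<in> carrier A \<longrightarrow> c \<in> D \<and> d \<in> D \<and> (sat e' f a c d \<or> refuted e' f a c d)"
      using dec TD by blast
    then have "(\<lambda>(a, c, d). sat e' f a c d) \<in> G S"
      unfolding G_def using e' by blast
    then show "G S \<noteq> {}" by blast
  next
    fix S T :: "('a \<times> 'a wit \<times> 'a wit) set"
    assume "S \<subseteq> T"
    then show "G T \<subseteq> G S" unfolding G_def by blast
  qed
  then obtain V where V: "\<And>S. finite S \<Longrightarrow> \<exists>v\<in>G S. \<forall>s\<in>S. v s = V s" by blast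
  have "approximable g (\<lambda>a c d. V (a, c, d))"
    unfolding approximable_def
  proof (intro allI impI)
    fix S :: "('a \<times> 'a wit \<times> 'a wit) set"
    assume S: "finite S" "fst ` S \<subseteq> carrier A"
    obtain D e f where D: "stage g D e f"
      and ok: "\<And>a c d. (a, c, d) \<in> S \<Longrightarrow> a \<in> carrier A \<Longrightarrow>
        c \<in> D \<and> d \<in> D \<and> (sat e f a c d \<or> refuted e f a c d)"
      and VS: "\<And>a c d. (a, c, d) \<in> S \<Longrightarrow> sat e f a c d = V (a, c, d)"
      using V[OF S(1)] unfolding G_def by fastforce
    have "c \<in> D \<and> d \<in> D \<and> (V (a, c, d) \<longleftrightarrow> sat e f a c d) \<and> (V (a, c, d) \<or> refuted e f a c d)"
      if "(a, c, d) \<in> S" for a c d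
      using ok[OF that] VS[OF that] S(2) that by force
    then show "\<exists>D e f. stage g D e f \<and> (\<forall>(a, c, d)\<in>S. c \<in> D \<and> d \<in> D \<and>
        (V (a, c, d) \<longleftrightarrow> sat e f a c d) \<and> (V (a, c, d) \<or> refuted e f a c d))"
      using D by blast
  qed
  then show ?thesis by blast
qed

lemma approximable_stage:
  assumes "approximable g V" "finite S" "fst ` S \<subseteq> carrier A"
  shows "\<exists>D e f. assignment D e f \<and> stage g D e f \<and> (\<forall>(a, c, d)\<in>S. c \<in> D \<and> d \<in> D \<and>
        (V a c d \<longleftrightarrow> sat e f a c d) \<and> (V a c d \<or> refuted e f a c d))"
proof -
  from assms have "\<exists>D e f. stage g D e f \<and> (\<forall>(a, c, d)\<in>S. c \<in> D \<and> d \<in> D \<and>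
        (V a c d \<longleftrightarrow> sat e f a c d) \<and> (V a c d \<or> refuted e f a c d))"
    unfolding approximable_def by simp
  then show ?thesis
  proof (elim exE conjE)
    fix D e f
    assume st: "stage g D e f" and "\<forall>(a, c, d)\<in>S. c \<in> D \<and> d \<in> D \<and>
        (V a c d \<longleftrightarrow> sat e f a c d) \<and> (V a c d \<or> refuted e f a c d)"
    moreover from st have "assignment D e f" by (simp add: stage_def)
    ultimately show ?thesis using st by (intro exI conjI)
  qed
qed

text \<open>Each clause, once the points are fixed, concerns finitely many statements and can be
  checked at one stage. The existential half of the composition clause is met by
  \<open>Via a b c d\<close>.\<close>

lemma approximable_model:
  assumes V: "approximable g V"
  shows "model A V"
  unfolding model_def
proof (intro conjI allI ballI)
  fix c d
  obtain D e f where D: "assignment D e f" "c \<in> D" "d \<in> D"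
      "V \<zero> c d \<longleftrightarrow> sat e f \<zero> c d" "V \<one> c d \<longleftrightarrow> sat e f \<one> c d" "V \<one>' c c \<longleftrightarrow> sat e f \<one>' c c"
    using approximable_stage[OF V, of "{(\<zero>, c, d), (\<one>, c, d), (\<one>', c, c)}"] by simp blast
  show "\<not> V \<zero> c d" using D not_sat_zero by simp
  show "V \<one> c d" using D sat_unit by simp
  show "V \<one>' c c" using D assignmentD(6) by simp
next
  fix a c d assume a: "a \<in> carrier A"
  obtain D e f where D: "assignment D e f" "c \<in> D" "d \<in> D"
      "V (a\<^sup>\<smile>) c d \<longleftrightarrow> sat e f (a\<^sup>\<smile>) c d" "V a d c \<longleftrightarrow> sat e f a d c"
    using approximable_stage[OF V, of "{(a\<^sup>\<smile>, c, d), (a, d, c)}"] a by simp blast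
  then show "V (a\<^sup>\<smile>) c d \<longleftrightarrow> V a d c"
    using sat_conv[OF D(1)] a by (metis conv_closed conv_conv)
next
  fix a b c d assume ab: "a \<in> carrier A" "b \<in> carrier A"
  obtain D e f where D: "assignment D e f" "c \<in> D" "d \<in> D"
      "V (a \<sqdot> b) c d \<longleftrightarrow> sat e f (a \<sqdot> b) c d" "V a c d \<longleftrightarrow> sat e f a c d" "V b c d \<longleftrightarrow> sat e f b c d"
    using approximable_stage[OF V, of "{(a \<sqdot> b, c, d), (a, c, d), (b, c, d)}"] ab by simp blast
  then show "V (a \<sqdot> b) c d \<longleftrightarrow> V a c d \<and> V b c d"
    using sat_meet ab by simp
  show "V (a ;; b) c d \<longleftrightarrow> (\<exists>k. V a c k \<and> V b k d)"
  proof
    assume *: "V (a ;; b) c d"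
    \<comment> \<open>Mentioning this term in the finite set forces it into \<open>D\<close>, where
      the stage condition applies to it.\<close>
    let ?k = "Via a b c d"
    obtain D e f where D: "assignment D e f" "stage g D e f" "?k \<in> D"
      "V (a ;; b) c d \<longleftrightarrow> sat e f (a ;; b) c d" "V a c ?k \<longleftrightarrow> sat e f a c ?k" "V b ?k d \<longleftrightarrow> sat e f b ?k d"
      using approximable_stage[OF V, of "{(a ;; b, c, d), (a, c, ?k), (b, ?k, d)}"] ab by simp blast
    have "\<not> refuted e f (a ;; b) c d" using sat_not_refuted[OF D(1)] * D(4) by blast
    then have "sat e f a c ?k \<and> sat e f b ?k d" using D(2,3) ab unfolding stage_def by blast
    then show "\<exists>k. V a c k \<and> V b k d" using D(5,6) by blast
  next
    assume "\<exists>k. V a c k \<and> V b k d"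
    then obtain k where *: "V a c k" "V b k d" by blast
    obtain D e f where D: "assignment D e f" "c \<in> D" "d \<in> D" "k \<in> D"
      "V (a ;; b) c d \<longleftrightarrow> sat e f (a ;; b) c d" "V a c k \<longleftrightarrow> sat e f a c k" "V b k d \<longleftrightarrow> sat e f b k d"
      using approximable_stage[OF V, of "{(a ;; b, c, d), (a, c, k), (b, k, d)}"] ab by simp blast
    then show "V (a ;; b) c d" using sat_relmult[OF D(1)] * ab by simp
  qed
qed

lemma model_mono: "\<lbrakk>model A V; V x c d; x \<preceq> y; x \<in> carrier A; y \<in> carrier A\<rbrakk> \<Longrightarrow> V y c d"
  using modelD(5)[of A V x y c d] by (simp add: leq_def)

text \<open>Take the domain of \<open>u\<close> for \<open>g\<close>. The limit satisfies
  \<open>g\<close>, hence \<open>u ;; u\<^sup>\<smile>\<close>, at \<open>Start\<close>, and the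
  composition clause yields the second point.\<close>

lemma approximable_nonempty:
  assumes tab: "tabular A" and u: "u \<in> carrier A" "u \<noteq> \<zero>"
  shows "\<exists>g V c d. approximable g V \<and> V u c d"
proof -
  define g where "g = pull u \<one>' u \<sqdot> \<one>'"
  have g: "g \<in> carrier A" "g \<preceq> \<one>'" using u by (simp_all add: g_def)
  have "g \<noteq> \<zero>"
  proof
    assume "g = \<zero>"
    then have "(u ;; u\<^sup>\<smile>) \<sqdot> \<one>' = \<zero>" using u by (simp add: g_def pull_ident)
    then have "u \<sqdot> u = \<zero>"
      using u schroeder_right[of u "u\<^sup>\<smile>" "\<one>'"] by (simp add: conv_conv)
    then show False using u by (simp add: meet_idem)
  qed
  then obtain V where V: "approximable g V" using approximable_exists[OF tab g] by blast
  obtain D e f where D: "stage g D e f" "V g Start Start \<longleftrightarrow> sat e f g Start Start"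
    using approximable_stage[OF V, of "{(g, Start, Start)}"] g by simp blast
  then have "V g Start Start" by (simp add: stage_def)
  moreover have "g \<preceq> u ;; u\<^sup>\<smile>" using u by (simp add: g_def pull_ident)
  ultimately have "V (u ;; u\<^sup>\<smile>) Start Start"
    using model_mono[OF approximable_model[OF V]] g u by simp
  then obtain k where "V u Start k"
    using approximable_model[OF V] u unfolding model_def by (meson conv_closed)
  then show ?thesis using V by blast
qed

text \<open>In place of a difference of \<open>x\<close> and \<open>y\<close>, tabularity is applied
  to \<open>y \<sqdot> x\<close> strictly below \<open>x\<close>; an element below \<open>x\<close>
  that misses \<open>y \<sqdot> x\<close> misses \<open>y\<close>.\<close>

lemma tabular_separates:
  assumes tab: "tabular A" and "x \<in> carrier A" "y \<in> carrier A" "x \<noteq> y"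
  shows "\<exists>z\<in>carrier A. z \<noteq> \<zero> \<and> (z \<preceq> x \<and> y \<sqdot> z = \<zero> \<or> z \<preceq> y \<and> x \<sqdot> z = \<zero>)"
proof -
  have *: "\<exists>z\<in>carrier A. z \<noteq> \<zero> \<and> z \<preceq> x \<and> y \<sqdot> z = \<zero>"
    if xy: "x \<in> carrier A" "y \<in> carrier A" "\<not> x \<preceq> y" for x y
  proof -
    have "lt A (y \<sqdot> x) x" using xy unfolding lt_def by (metis meet_le1 meet_le2)
    then have "\<exists>p\<in>carrier A. \<exists>q\<in>carrier A. \<zero> \<noteq> p\<^sup>\<smile> ;; q \<and> p\<^sup>\<smile> ;; q \<preceq> x \<and> (y \<sqdot> x) \<sqdot> (p\<^sup>\<smile> ;; q) = \<zero>"
      using tab xy unfolding tabular_def by (meson meet_closed)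
    then obtain z where z: "z \<in> carrier A" "z \<noteq> \<zero>" "z \<preceq> x" "(y \<sqdot> x) \<sqdot> z = \<zero>"
      by (metis conv_closed relmult_closed)
    then have "y \<sqdot> z = \<zero>"
      using xy by (metis leq_def meet_assoc meet_comm)
    then show ?thesis using z by blast
  qed
  have "\<not> x \<preceq> y \<or> \<not> y \<preceq> x" using assms le_antisym by blast
  then show ?thesis using * assms(2,3) by metis
qed

end

subsection \<open>The representation\<close>

text \<open>
  Points of a model that the identity relates are identified by keeping only one representative
  of each class.
\<close>

definition reps :: "('a, 'm) J_sig_scheme \<Rightarrow> ('a \<Rightarrow> 'c \<Rightarrow> 'c \<Rightarrow> bool) \<Rightarrow> 'c set" where
  "reps A V = range (\<lambda>c. SOME d. V \<one>'\<^bsub>A\<^esub> c d)"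

text \<open>A disjoint union of full relations, one block for each index, so that many models fit
  into a single representation.\<close>

definition points :: "('a, 'm) J_sig_scheme \<Rightarrow> ('i \<Rightarrow> 'a \<Rightarrow> 'c \<Rightarrow> 'c \<Rightarrow> bool) \<Rightarrow> 'i set \<Rightarrow> ('i \<times> 'c) rel" where
  "points A V I = {((i, c), (j, d)). i = j \<and> i \<in> I \<and> c \<in> reps A (V i) \<and> d \<in> reps A (V i)}"

definition rep_map ::
  "('a, 'm) J_sig_scheme \<Rightarrow> ('i \<Rightarrow> 'a \<Rightarrow> 'c \<Rightarrow> 'c \<Rightarrow> bool) \<Rightarrow> 'i set \<Rightarrow> 'a \<Rightarrow> ('i \<times> 'c) rel" where
  "rep_map A V I a =
     {((i, c), (j, d)). i = j \<and> i \<in> I \<and> c \<in> reps A (V i) \<and> d \<in> reps A (V i) \<and> V i a c d}"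

lemma equiv_points: "equiv (Field (points A V I)) (points A V I)"
proof (rule equivI)
  show "points A V I \<subseteq> Field (points A V I) \<times> Field (points A V I)" by (auto simp: Field_def)
  show "refl_on (Field (points A V I)) (points A V I)"
    by (auto simp: refl_on_def Field_def points_def)
  show "sym (points A V I)" by (auto simp: sym_def points_def)
  show "trans (points A V I)" by (auto simp: trans_def points_def)
qed

context J_algebra
begin

lemma model_ident:
  assumes V: "model A V" and a: "a \<in> carrier A"
  shows "V \<one>' c d \<Longrightarrow> V \<one>' d c"
    and "\<lbrakk>V a c k; V \<one>' k d\<rbrakk> \<Longrightarrow> V a c d"
    and "\<lbrakk>V \<one>' c k; V a k d\<rbrakk> \<Longrightarrow> V a c d"
proof -
  show "V \<one>' d c" if "V \<one>' c d"
    using V that conv_ident unfolding model_def by (metis ident_closed)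
  show "V a c d" if "V a c k" "V \<one>' k d"
    using V that a relmult_ident[OF a] unfolding model_def by (metis ident_closed)
  show "V a c d" if "V \<one>' c k" "V a k d"
    using V that a ident_relmult[OF a] unfolding model_def by (metis ident_closed)
qed

lemma reps_ex:
  assumes V: "model A V"
  obtains d where "d \<in> reps A V" "V \<one>' c d"
proof -
  have "V \<one>' c c" using V by (simp add: model_def)
  then have "V \<one>' c (SOME d. V \<one>' c d)" by (rule someI)
  then show ?thesis using that unfolding reps_def by blast
qed

text \<open>Points related by the identity have the same predicate \<open>V \<one>' c\<close>, so
  the choice operator selects the same representative for both.\<close>

lemma reps_unique:
  assumes V: "model A V" and "c \<in> reps A V" "d \<in> reps A V" "V \<one>' c d"
  shows "c = d"
proof -
  note id = model_ident[OF V ident_closed]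
  obtain c' d' where c': "c = (SOME x. V \<one>' c' x)" and d': "d = (SOME x. V \<one>' d' x)"
    using assms unfolding reps_def by blast
  have "V \<one>' c' c" "V \<one>' d' d"
    using V unfolding c' d' model_def by (metis someI)+
  then have "V \<one>' c' d'" using assms id by blast
  then have "V \<one>' c' = V \<one>' d'" using id by blast
  then show ?thesis using c' d' by simp
qed

lemma rep_map_hom:
  assumes V: "\<And>i. i \<in> I \<Longrightarrow> model A (V i)"
  shows "J_hom (rep_map A V I) A (J_powerset (points A V I))"
proof -
  note mD = modelD[OF V]
  have relm: "rep_map A V I (x ;; y) = rep_map A V I x O rep_map A V I y"
    if xy: "x \<in> carrier A" "y \<in> carrier A" for x y
  proof (intro equalityI subsetI)
    fix z assume "z \<in> rep_map A V I (x ;; y)"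
    then obtain i c d where z: "z = ((i, c), (i, d))" "i \<in> I" "c \<in> reps A (V i)" "d \<in> reps A (V i)"
      "V i (x ;; y) c d" by (auto simp: rep_map_def)
    then obtain k where k: "V i x c k" "V i y k d" using mD(6)[OF z(2) xy] by blast
    \<comment> \<open>The midpoint need not be a representative; the representative of its class
      stands in the same relations.\<close>
    obtain k' where k': "k' \<in> reps A (V i)" "V i \<one>' k k'"
      using reps_ex[OF V[OF z(2)]] by blast
    have "V i x c k'"
      using model_ident(2)[OF V[OF z(2)] xy(1) k(1) k'(2)] .
    moreover have "V i y k' d"
      using model_ident(3)[OF V[OF z(2)] xy(2) model_ident(1)[OF V[OF z(2)] xy(2) k'(2)] k(2)] .
    ultimately show "z \<in> rep_map A V I x O rep_map A V I y"
      using z k' by (auto simp: rep_map_def)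
  next
    fix z assume "z \<in> rep_map A V I x O rep_map A V I y"
    then show "z \<in> rep_map A V I (x ;; y)" using xy by (auto simp: rep_map_def mD(6))
  qed
  have ident: "rep_map A V I \<one>' = {(x, x) |x. (x, x) \<in> points A V I}"
    by (auto simp: rep_map_def points_def mD(3) dest: reps_unique[OF V])
  show ?thesis
    unfolding J_hom_def
  proof (intro conjI ballI)
    show "rep_map A V I ` carrier A \<subseteq> carrier (J_powerset (points A V I))"
      by (auto simp: J_powerset_def rep_map_def points_def)
  next
    fix x y assume xy: "x \<in> carrier A" "y \<in> carrier A"
    show "rep_map A V I (x \<sqdot> y) = rep_map A V I x \<sqdot>\<^bsub>J_powerset (points A V I)\<^esub> rep_map A V I y"
      using xy by (auto simp: J_powerset_def rep_map_def mD(5))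
    show "rep_map A V I (x ;; y) = rep_map A V I x ;;\<^bsub>J_powerset (points A V I)\<^esub> rep_map A V I y"
      using relm[OF xy] by (simp add: J_powerset_def)
  next
    fix x assume x: "x \<in> carrier A"
    show "rep_map A V I (x\<^sup>\<smile>) = (rep_map A V I x)\<^sup>\<smile>\<^bsub>J_powerset (points A V I)\<^esub>"
      using x by (auto simp: J_powerset_def rep_map_def mD(4))
  next
    show "rep_map A V I \<zero> = \<zero>\<^bsub>J_powerset (points A V I)\<^esub>"
      by (auto simp: J_powerset_def rep_map_def mD(1))
    show "rep_map A V I \<one> = \<one>\<^bsub>J_powerset (points A V I)\<^esub>"
      by (auto simp: J_powerset_def rep_map_def points_def mD(2))
    show "rep_map A V I \<one>' = \<one>'\<^bsub>J_powerset (points A V I)\<^esub>"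
      using ident by (simp add: J_powerset_def)
  qed
qed

lemma rep_map_inj:
  assumes tab: "tabular A" and V: "\<And>i. i \<in> I \<Longrightarrow> model A (V i)"
    and ne: "\<And>u. \<lbrakk>u \<in> carrier A; u \<noteq> \<zero>\<rbrakk> \<Longrightarrow> \<exists>i\<in>I. \<exists>c d. V i u c d"
  shows "inj_on (rep_map A V I) (carrier A)"
proof (rule inj_onI, rule ccontr)
  fix x y assume xy: "x \<in> carrier A" "y \<in> carrier A" "rep_map A V I x = rep_map A V I y" "x \<noteq> y"
  have False if z: "z \<in> carrier A" "z \<noteq> \<zero>" "z \<preceq> x" "y \<sqdot> z = \<zero>"
    and xy: "x \<in> carrier A" "y \<in> carrier A" "rep_map A V I x = rep_map A V I y" for x y z
  proof -
    obtain i c d where i: "i \<in> I" "V i z c d" using ne z by blast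
    note id = model_ident[OF V[OF i(1)]]
    obtain c' d' where c': "c' \<in> reps A (V i)" "V i \<one>' c c'" and d': "d' \<in> reps A (V i)" "V i \<one>' d d'"
      using reps_ex[OF V[OF i(1)]] by metis
    \<comment> \<open>The pair is moved to representatives, the only points that
      \<open>rep_map\<close> sees.\<close>
    have zcd: "V i z c' d'" using id z(1) c' d' i(2) by (metis ident_closed)
    then have "V i x c' d'" using model_mono[OF V[OF i(1)]] z xy by blast
    then have "((i, c'), (i, d')) \<in> rep_map A V I y"
      using i c' d' xy(3)[symmetric] by (auto simp: rep_map_def)
    then have "V i y c' d'" by (simp add: rep_map_def)
    then have "V i (y \<sqdot> z) c' d'" using zcd V[OF i(1)] xy z unfolding model_def by blast
    then show False using z V[OF i(1)] unfolding model_def by simp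
  qed
  then show False using tabular_separates[OF tab xy(1,2,4)] xy by metis
qed

text \<open>The models are indexed by the nonzero elements, \<open>u\<close> being nonempty in its
  own model. Approximability is retained because the model clauses do not speak of
  complements.\<close>

lemma ex_separating_family:
  assumes tab: "tabular A"
  obtains V :: "'a \<Rightarrow> 'a \<Rightarrow> 'a wit \<Rightarrow> 'a wit \<Rightarrow> bool" and g
  where "\<And>u. u \<in> carrier A - {\<zero>} \<Longrightarrow> approximable (g u) (V u)"
    and "inj_on (rep_map A V (carrier A - {\<zero>})) (carrier A)"
    and "J_hom (rep_map A V (carrier A - {\<zero>})) A (J_powerset (points A V (carrier A - {\<zero>})))"
proof -
  let ?I = "carrier A - {\<zero>}"
  have "\<forall>u\<in>?I. \<exists>g V. approximable g V \<and> (\<exists>c d. V u c d)"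
    using approximable_nonempty[OF tab] by blast
  then obtain g V where V: "\<And>u. u \<in> ?I \<Longrightarrow> approximable (g u) (V u)"
    and ne: "\<And>u. u \<in> ?I \<Longrightarrow> \<exists>c d. V u u c d" by metis
  have V': "model A (V u)" if "u \<in> ?I" for u using approximable_model[OF V[OF that]] .
  have "inj_on (rep_map A V ?I) (carrier A)"
  proof (rule rep_map_inj[OF tab])
    fix u assume "u \<in> carrier A" "u \<noteq> \<zero>"
    then show "\<exists>i\<in>?I. \<exists>c d. V i u c d" using ne[of u] by (intro bexI[of _ u]) simp_all
  qed (rule V')
  from that[OF V this rep_map_hom[OF V']] show ?thesis .
qed

end

lemma tabular_J_algebra_representable:
  assumes "J_algebra A" and tab: "tabular A"
  shows "J_representable A"
proof -
  interpret J_algebra A by fact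
  let ?I = "carrier A - {\<zero>\<^bsub>A\<^esub>}"
  obtain V :: "'a \<Rightarrow> 'a \<Rightarrow> 'a wit \<Rightarrow> 'a wit \<Rightarrow> bool"
    where "inj_on (rep_map A V ?I) (carrier A)" "J_hom (rep_map A V ?I) A (J_powerset (points A V ?I))"
    using ex_separating_family[OF tab] by metis
  then have "J_representable_over (points A V ?I) A"
    using equiv_points J_representable_over_iff[OF J_structure_axioms] by blast
  \<comment> \<open>The points constructed so far are pairs of an index and a \<open>wit\<close>
    term; the representation is transferred to the prescribed base type.\<close>
  then show ?thesis by (rule J_representableI[OF J_structure_axioms])
qed

subsection \<open>Relation algebras are J-algebras\<close>

context relation_algebra
begin

declare meet_closed [simp, intro] zero_closed [simp, intro] unit_closed [simp, intro]
  relmult_closed [simp, intro] conv_closed [simp, intro] ident_closed [simp, intro]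
  join_closed [simp, intro] compl_closed [simp, intro]

section \<open>Boolean algebra from Huntington's axiom\<close>

lemma join_left_comm:
  "\<lbrakk>x \<in> carrier A; y \<in> carrier A; z \<in> carrier A\<rbrakk> \<Longrightarrow> x \<squnion> (y \<squnion> z) = y \<squnion> (x \<squnion> z)"
  by (metis join_assoc join_comm)

text \<open>Huntington's axiom splits \<open>x\<close> and its complement along \<open>y\<close>,
  and \<open>y\<close> and its complement along \<open>x\<close>. Both sides become the join of the
  same four pieces.\<close>

lemma join_compl_eq:
  assumes "x \<in> carrier A" "y \<in> carrier A"
  shows "x \<squnion> \<sim>x = y \<squnion> \<sim>y"
proof -
  define p q r s where "p = \<sim>(\<sim>x \<squnion> \<sim>\<sim>y)" and "q = \<sim>(\<sim>x \<squnion> \<sim>y)"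
    and "r = \<sim>(\<sim>\<sim>x \<squnion> \<sim>\<sim>y)" and "s = \<sim>(\<sim>\<sim>x \<squnion> \<sim>y)"
  have cl: "p \<in> carrier A" "q \<in> carrier A" "r \<in> carrier A" "s \<in> carrier A"
    using assms by (simp_all add: p_def q_def r_def s_def)
  have "x = p \<squnion> q" "\<sim>x = r \<squnion> s" "y = s \<squnion> q" "\<sim>y = r \<squnion> p"
    using assms huntington[of x "\<sim>y"] huntington[of "\<sim>x" "\<sim>y"]
      huntington[of y "\<sim>x"] huntington[of "\<sim>y" "\<sim>x"]
    by (simp_all add: p_def q_def r_def s_def join_comm)
  then have "x \<squnion> \<sim>x = (p \<squnion> q) \<squnion> (r \<squnion> s)" "y \<squnion> \<sim>y = (s \<squnion> q) \<squnion> (r \<squnion> p)" by simp_all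
  then show ?thesis
    using cl by (simp add: join_assoc[symmetric] join_comm join_left_comm)
qed

lemma join_compl [simp]: "x \<in> carrier A \<Longrightarrow> x \<squnion> \<sim>x = \<one>"
  using join_compl_eq[of x "\<one>'"] unit_eq by simp

lemma compl_join [simp]: "x \<in> carrier A \<Longrightarrow> \<sim>x \<squnion> x = \<one>"
  by (metis compl_closed join_comm join_compl)

text \<open>Huntington expansions of both sides agree term by term, because any element joined with
  its complement gives the same unit.\<close>

lemma compl_compl [simp]:
  assumes "x \<in> carrier A"
  shows "\<sim>\<sim>x = x"
proof -
  have "\<sim>\<sim>x = \<sim>(\<sim>\<sim>\<sim>x \<squnion> \<sim>\<sim>x) \<squnion> \<sim>(\<sim>\<sim>\<sim>x \<squnion> \<sim>x)"
    using assms huntington[of "\<sim>\<sim>x" "\<sim>x"] by simp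
  moreover have "x = \<sim>(\<sim>x \<squnion> \<sim>\<sim>\<sim>x) \<squnion> \<sim>(\<sim>x \<squnion> \<sim>\<sim>x)"
    using assms huntington[of x "\<sim>\<sim>x"] by simp
  moreover have "\<sim>\<sim>\<sim>x \<squnion> \<sim>\<sim>x = \<sim>x \<squnion> \<sim>\<sim>x" using assms by simp
  ultimately show ?thesis
    using assms by (metis compl_closed join_closed join_comm)
qed

text \<open>Huntington's axiom shows that \<open>\<zero>\<close>, and hence \<open>\<one>\<close>,
  absorbs the complement of \<open>\<one> \<squnion> \<one>\<close>. Regrouping a further join with
  \<open>\<one>\<close> turns it into an element joined with its complement.\<close>

lemma unit_join_unit: "\<one> \<squnion> \<one> = \<one>"
proof -
  have one: "\<one> \<squnion> \<zero> = \<one>" using join_compl[of \<one>] by (simp add: zero_eq)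
  have "\<zero> = \<sim>(\<one> \<squnion> \<zero>) \<squnion> \<sim>(\<one> \<squnion> \<one>)"
    using huntington[of "\<sim>\<one>" \<one>] unfolding zero_eq by simp
  then have zero: "\<zero> \<squnion> \<sim>(\<one> \<squnion> \<one>) = \<zero>" using one zero_eq by metis
  have "\<one> \<squnion> \<sim>(\<one> \<squnion> \<one>) = (\<one> \<squnion> \<zero>) \<squnion> \<sim>(\<one> \<squnion> \<one>)" by (simp only: one)
  also have "\<dots> = \<one> \<squnion> (\<zero> \<squnion> \<sim>(\<one> \<squnion> \<one>))" by (rule join_assoc[symmetric]) simp_all
  also have "\<dots> = \<one>" by (simp only: zero one)
  finally have "\<one> \<squnion> \<one> = \<one> \<squnion> (\<one> \<squnion> \<sim>(\<one> \<squnion> \<one>))" by simp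
  also have "\<dots> = (\<one> \<squnion> \<one>) \<squnion> \<sim>(\<one> \<squnion> \<one>)" by (rule join_assoc) simp_all
  also have "\<dots> = \<one>" by simp
  finally show ?thesis .
qed

lemma zero_join_zero: "\<zero> \<squnion> \<zero> = \<zero>"
proof -
  have "\<one> \<squnion> \<zero> = \<one>" using join_compl[of \<one>] by (simp add: zero_eq)
  then show ?thesis
    using huntington[of "\<sim>\<one>" \<one>] unit_join_unit by (simp add: zero_eq)
qed

lemma join_zero [simp]:
  assumes "x \<in> carrier A"
  shows "x \<squnion> \<zero> = x"
proof -
  have "x = \<sim>(\<sim>x \<squnion> \<sim>x) \<squnion> \<zero>" using huntington[of x x] assms by (simp add: zero_eq)
  then show ?thesis using assms zero_join_zero
    by (metis compl_closed join_assoc join_closed zero_closed)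
qed

lemma join_idem [simp]:
  assumes "x \<in> carrier A"
  shows "x \<squnion> x = x"
proof -
  have "\<sim>x = \<sim>(x \<squnion> x)" using huntington[of "\<sim>x" "\<sim>x"] assms by (simp add: zero_eq[symmetric])
  then show ?thesis using assms by (metis compl_compl join_closed)
qed

lemma join_meet_absorb:
  assumes "x \<in> carrier A" "y \<in> carrier A"
  shows "x \<squnion> (x \<sqdot> y) = x"
proof -
  have "x = (x \<sqdot> y) \<squnion> \<sim>(\<sim>x \<squnion> y)" using huntington[of x y] assms by (simp add: meet_eq)
  then have "x \<squnion> (x \<sqdot> y) = ((x \<sqdot> y) \<squnion> \<sim>(\<sim>x \<squnion> y)) \<squnion> (x \<sqdot> y)" by simp
  also have "\<dots> = (x \<sqdot> y) \<squnion> \<sim>(\<sim>x \<squnion> y)"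
    using assms by (metis compl_closed join_assoc join_closed join_comm join_idem meet_closed)
  finally show ?thesis using huntington[of x y] assms by (simp add: meet_eq)
qed

lemma de_morgan:
  assumes "x \<in> carrier A" "y \<in> carrier A"
  shows "\<sim>(x \<squnion> y) = \<sim>x \<sqdot> \<sim>y" "\<sim>(x \<sqdot> y) = \<sim>x \<squnion> \<sim>y"
  using assms by (simp_all add: meet_eq)

lemma leq_iff_join:
  assumes "x \<in> carrier A" "y \<in> carrier A"
  shows "leq A x y \<longleftrightarrow> x \<squnion> y = y"
proof
  assume "leq A x y"
  then show "x \<squnion> y = y"
    using assms join_meet_absorb[of y x] by (simp add: leq_def meet_eq join_comm)
next
  assume *: "x \<squnion> y = y"
  have "\<sim>x \<squnion> (\<sim>x \<sqdot> \<sim>y) = \<sim>x" using assms by (simp add: join_meet_absorb)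
  then have "\<sim>x \<squnion> \<sim>y = \<sim>x" using assms * by (metis de_morgan(1))
  then show "leq A x y" using assms by (simp add: leq_def meet_eq)
qed

lemma meet_assoc:
  "\<lbrakk>x \<in> carrier A; y \<in> carrier A; z \<in> carrier A\<rbrakk> \<Longrightarrow> x \<sqdot> (y \<sqdot> z) = (x \<sqdot> y) \<sqdot> z"
  by (simp add: meet_eq join_assoc)

lemma meet_comm: "\<lbrakk>x \<in> carrier A; y \<in> carrier A\<rbrakk> \<Longrightarrow> x \<sqdot> y = y \<sqdot> x"
  by (simp add: meet_eq join_comm)

lemma meet_idem: "x \<in> carrier A \<Longrightarrow> x \<sqdot> x = x"
  by (simp add: meet_eq)

lemma zero_meet: "x \<in> carrier A \<Longrightarrow> \<zero> \<sqdot> x = \<zero>"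
  using leq_iff_join[of \<zero> x] by (simp add: leq_def join_comm)

lemma meet_zero: "x \<in> carrier A \<Longrightarrow> x \<sqdot> \<zero> = \<zero>"
  by (metis meet_comm zero_closed zero_meet)

lemma meet_disjoint:
  "\<lbrakk>y \<sqdot> z = \<zero>; x \<in> carrier A; y \<in> carrier A; z \<in> carrier A\<rbrakk> \<Longrightarrow> (x \<sqdot> z) \<sqdot> y = \<zero>"
  by (metis meet_assoc meet_comm meet_zero)

lemma meet_unit: "x \<in> carrier A \<Longrightarrow> x \<sqdot> \<one> = x"
  using zero_eq[symmetric] by (simp add: meet_eq)

lemma leq_meet:
  assumes "x \<in> carrier A" "y \<in> carrier A" "z \<in> carrier A"
  shows "leq A (x \<sqdot> y) x" "leq A (x \<sqdot> y) y" "\<lbrakk>leq A z x; leq A z y\<rbrakk> \<Longrightarrow> leq A z (x \<sqdot> y)"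
  using assms unfolding leq_def by (metis meet_assoc meet_comm meet_idem meet_closed)+

lemma leq_trans:
  "\<lbrakk>leq A x y; leq A y z; x \<in> carrier A; y \<in> carrier A; z \<in> carrier A\<rbrakk> \<Longrightarrow> leq A x z"
  unfolding leq_def by (metis meet_assoc)

lemma meet_leq_mono:
  "\<lbrakk>leq A x x'; leq A y y'; x \<in> carrier A; x' \<in> carrier A; y \<in> carrier A; y' \<in> carrier A\<rbrakk>
    \<Longrightarrow> leq A (x \<sqdot> y) (x' \<sqdot> y')"
  by (meson leq_meet leq_trans meet_closed)

lemma leq_refl: "x \<in> carrier A \<Longrightarrow> leq A x x"
  by (simp add: leq_def meet_idem)

lemma leq_antisym: "\<lbrakk>leq A x y; leq A y x; x \<in> carrier A; y \<in> carrier A\<rbrakk> \<Longrightarrow> x = y"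
  unfolding leq_def by (metis meet_comm)

lemma meet_compl [simp]: "x \<in> carrier A \<Longrightarrow> x \<sqdot> \<sim>x = \<zero>"
  by (simp add: meet_eq zero_eq)

lemma disjoint_iff_leq_compl:
  assumes "x \<in> carrier A" "y \<in> carrier A"
  shows "x \<sqdot> y = \<zero> \<longleftrightarrow> leq A x (\<sim>y)"
proof
  assume "x \<sqdot> y = \<zero>"
  then have "x = \<zero> \<squnion> (x \<sqdot> \<sim>y)" using huntington[of x y] assms by (simp add: meet_eq)
  then have "x \<sqdot> \<sim>y = x" using assms join_zero[of "x \<sqdot> \<sim>y"] by (simp add: join_comm)
  then show "leq A x (\<sim>y)" by (simp add: leq_def)
next
  assume "leq A x (\<sim>y)"
  then have "x \<sqdot> y = (x \<sqdot> \<sim>y) \<sqdot> y" by (simp add: leq_def)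
  also have "\<dots> = x \<sqdot> (\<sim>y \<sqdot> y)" using assms by (simp add: meet_assoc)
  also have "\<dots> = \<zero>" using assms by (metis compl_closed meet_comm meet_compl meet_zero)
  finally show "x \<sqdot> y = \<zero>" .
qed

text \<open>The part of \<open>z\<close> outside \<open>u\<close> lies below both
  \<open>u \<squnion> v\<close> and its complement, so it vanishes.\<close>

lemma disjoint_join_leq:
  assumes "leq A z (u \<squnion> v)" "z \<sqdot> v = \<zero>" "z \<in> carrier A" "u \<in> carrier A" "v \<in> carrier A"
  shows "leq A z u"
proof -
  have zv: "leq A z (\<sim>v)" using assms by (simp add: disjoint_iff_leq_compl)
  have "leq A (z \<sqdot> \<sim>u) (\<sim>u \<sqdot> \<sim>v)"
    using assms zv by (meson leq_meet leq_trans compl_closed meet_closed)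
  then have "leq A (z \<sqdot> \<sim>u) (\<sim>(u \<squnion> v))" using assms by (simp add: de_morgan)
  moreover have "leq A (z \<sqdot> \<sim>u) (\<sim>(\<sim>(u \<squnion> v)))"
    using leq_trans[OF leq_meet(1)[of z "\<sim>u" z] assms(1)] assms by simp
  ultimately have "(z \<sqdot> \<sim>u) \<sqdot> (z \<sqdot> \<sim>u) = \<zero>"
    using assms disjoint_iff_leq_compl[of "z \<sqdot> \<sim>u" "\<sim>(u \<squnion> v)"] by (simp add: leq_def meet_idem)
  then have "z \<sqdot> \<sim>u = \<zero>" using assms by (simp add: meet_idem)
  then show ?thesis using assms disjoint_iff_leq_compl[of z "\<sim>u"] by simp
qed

section \<open>Converse, composition and the rotation law\<close>

lemma conv_leq: "\<lbrakk>leq A x y; x \<in> carrier A; y \<in> carrier A\<rbrakk> \<Longrightarrow> leq A (x\<^sup>\<smile>) (y\<^sup>\<smile>)"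
  by (metis conv_closed conv_join leq_iff_join)

lemma relmult_leq_left:
  "\<lbrakk>leq A x y; x \<in> carrier A; y \<in> carrier A; z \<in> carrier A\<rbrakk> \<Longrightarrow> leq A (x ;; z) (y ;; z)"
  by (metis leq_iff_join relmult_closed relmult_join_distrib)

lemma relmult_join_distrib_left:
  assumes "x \<in> carrier A" "y \<in> carrier A" "z \<in> carrier A"
  shows "z ;; (x \<squnion> y) = (z ;; x) \<squnion> (z ;; y)"
proof -
  have "(z ;; (x \<squnion> y))\<^sup>\<smile> = ((z ;; x) \<squnion> (z ;; y))\<^sup>\<smile>"
    using assms by (simp add: conv_relmult conv_join relmult_join_distrib)
  then show ?thesis using assms by (metis conv_conv join_closed relmult_closed)
qed

lemma relmult_leq_right:
  "\<lbrakk>leq A x y; x \<in> carrier A; y \<in> carrier A; z \<in> carrier A\<rbrakk> \<Longrightarrow> leq A (z ;; x) (z ;; y)"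
  by (metis leq_iff_join relmult_closed relmult_join_distrib_left)

lemma conv_meet_distrib:
  assumes "x \<in> carrier A" "y \<in> carrier A"
  shows "(x \<sqdot> y)\<^sup>\<smile> = x\<^sup>\<smile> \<sqdot> y\<^sup>\<smile>"
proof (rule leq_antisym)
  show "leq A ((x \<sqdot> y)\<^sup>\<smile>) (x\<^sup>\<smile> \<sqdot> y\<^sup>\<smile>)"
    using assms by (intro leq_meet(3) conv_leq leq_meet(1,2)) auto
  have "leq A ((x\<^sup>\<smile> \<sqdot> y\<^sup>\<smile>)\<^sup>\<smile>) (x\<^sup>\<smile>\<^sup>\<smile> \<sqdot> y\<^sup>\<smile>\<^sup>\<smile>)"
    using assms by (intro leq_meet(3) conv_leq leq_meet(1,2)) auto
  then have "leq A ((x\<^sup>\<smile> \<sqdot> y\<^sup>\<smile>)\<^sup>\<smile>\<^sup>\<smile>) ((x \<sqdot> y)\<^sup>\<smile>)"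
    using assms by (intro conv_leq) (simp_all add: conv_conv)
  then show "leq A (x\<^sup>\<smile> \<sqdot> y\<^sup>\<smile>) ((x \<sqdot> y)\<^sup>\<smile>)" using assms by (simp add: conv_conv)
qed (use assms in auto)

lemma conv_zero: "\<zero>\<^sup>\<smile> = \<zero>"
  by (metis conv_closed conv_conv conv_meet_distrib meet_zero zero_closed zero_meet)

text \<open>Tarski's axiom is the case of the largest admissible \<open>z\<close>, the complement of
  \<open>x ;; y\<close>; monotonicity gives the rest.\<close>

lemma schroeder_left:
  assumes "x \<in> carrier A" "y \<in> carrier A" "z \<in> carrier A" "(x ;; y) \<sqdot> z = \<zero>"
  shows "(x\<^sup>\<smile> ;; z) \<sqdot> y = \<zero>"
proof -
  have "leq A z (\<sim>(x ;; y))"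
    using assms disjoint_iff_leq_compl[of z "x ;; y"] meet_comm[of z "x ;; y"] by simp
  then have "leq A (x\<^sup>\<smile> ;; z) (x\<^sup>\<smile> ;; \<sim>(x ;; y))"
    using assms by (intro relmult_leq_right) simp_all
  moreover have "leq A (x\<^sup>\<smile> ;; \<sim>(x ;; y)) (\<sim>y)"
    using assms tarski[of x y] by (simp add: leq_iff_join)
  ultimately have "leq A (x\<^sup>\<smile> ;; z) (\<sim>y)"
    using assms by (meson leq_trans compl_closed conv_closed relmult_closed)
  then show ?thesis using assms by (simp add: disjoint_iff_leq_compl)
qed

lemma schroeder_right:
  assumes "x \<in> carrier A" "y \<in> carrier A" "z \<in> carrier A" "(z ;; y\<^sup>\<smile>) \<sqdot> x = \<zero>"
  shows "(x ;; y) \<sqdot> z = \<zero>"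
proof -
  have "((z ;; y\<^sup>\<smile>) \<sqdot> x)\<^sup>\<smile> = \<zero>" using assms by (simp add: conv_zero)
  then have "(y ;; z\<^sup>\<smile>) \<sqdot> x\<^sup>\<smile> = \<zero>"
    using assms(1-3) by (simp add: conv_meet_distrib conv_relmult conv_conv)
  then have "(y\<^sup>\<smile> ;; x\<^sup>\<smile>) \<sqdot> z\<^sup>\<smile> = \<zero>"
    using assms(1-3) by (intro schroeder_left) simp_all
  then have "((x ;; y) \<sqdot> z)\<^sup>\<smile> = \<zero>"
    using assms(1-3) by (simp add: conv_meet_distrib conv_relmult)
  then show ?thesis using assms(1-3) by (metis conv_conv conv_zero meet_closed relmult_closed)
qed

lemma leq_meet_join_compl:
  assumes "x \<in> carrier A" "y \<in> carrier A"
  shows "x = (x \<sqdot> y) \<squnion> (x \<sqdot> \<sim>y)"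
  using huntington[of x y] assms by (simp add: meet_eq)

text \<open>Split \<open>x\<close> along \<open>z ;; y\<^sup>\<smile>\<close>. By
  \<open>schroeder_right\<close> the part of \<open>x\<close> outside contributes nothing to the
  product within \<open>z\<close>.\<close>

lemma relmult_meet_leq_left:
  assumes "x \<in> carrier A" "y \<in> carrier A" "z \<in> carrier A"
  shows "leq A ((x ;; y) \<sqdot> z) (((z ;; y\<^sup>\<smile>) \<sqdot> x) ;; y)"
proof (rule disjoint_join_leq)
  let ?u = "(z ;; y\<^sup>\<smile>) \<sqdot> x" and ?v = "x \<sqdot> \<sim>(z ;; y\<^sup>\<smile>)"
  have "x = ?u \<squnion> ?v"
    using assms leq_meet_join_compl[of x "z ;; y\<^sup>\<smile>"] meet_comm[of x "z ;; y\<^sup>\<smile>"] by simp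
  then have "x ;; y = (?u ;; y) \<squnion> (?v ;; y)"
    using assms relmult_join_distrib[of ?u ?v y] by simp
  then show "leq A ((x ;; y) \<sqdot> z) ((?u ;; y) \<squnion> (?v ;; y))"
    using assms leq_meet(1)[of "x ;; y" z z] by simp
  have "leq A ?v (\<sim>(z ;; y\<^sup>\<smile>))" using assms by (intro leq_meet(2)) simp_all
  then have "(z ;; y\<^sup>\<smile>) \<sqdot> ?v = \<zero>"
    using assms disjoint_iff_leq_compl[of ?v "z ;; y\<^sup>\<smile>"] meet_comm[of ?v "z ;; y\<^sup>\<smile>"] by simp
  then have "(?v ;; y) \<sqdot> z = \<zero>" using assms by (intro schroeder_right[of ?v]) simp_all
  then show "((x ;; y) \<sqdot> z) \<sqdot> (?v ;; y) = \<zero>"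
    by (rule meet_disjoint) (use assms in simp_all)
qed (use assms in auto)

lemma relmult_meet_leq_right:
  assumes "x \<in> carrier A" "y \<in> carrier A" "z \<in> carrier A"
  shows "leq A ((x ;; y) \<sqdot> z) (x ;; (y \<sqdot> (x\<^sup>\<smile> ;; z)))"
proof -
  have "leq A (((y\<^sup>\<smile> ;; x\<^sup>\<smile>) \<sqdot> z\<^sup>\<smile>)\<^sup>\<smile>) ((((z\<^sup>\<smile> ;; x\<^sup>\<smile>\<^sup>\<smile>) \<sqdot> y\<^sup>\<smile>) ;; x\<^sup>\<smile>)\<^sup>\<smile>)"
    using assms by (intro conv_leq relmult_meet_leq_left) simp_all
  then show ?thesis
    using assms meet_comm[of y "x\<^sup>\<smile> ;; z"]
    by (simp add: conv_meet_distrib conv_relmult conv_conv)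
qed

text \<open>The left factor is restricted first, then the right one relative to the restricted left
  factor \<open>u\<close>; finally \<open>u\<^sup>\<smile>\<close> is enlarged to
  \<open>x\<^sup>\<smile>\<close>. The reverse inequality is monotonicity.\<close>

lemma rotation_law:
  assumes "x \<in> carrier A" "y \<in> carrier A" "z \<in> carrier A"
  shows "(x ;; y) \<sqdot> z = (((z ;; y\<^sup>\<smile>) \<sqdot> x) ;; (y \<sqdot> (x\<^sup>\<smile> ;; z))) \<sqdot> z"
proof (rule leq_antisym)
  define u where "u = (z ;; y\<^sup>\<smile>) \<sqdot> x"
  have u: "u \<in> carrier A" "leq A u x" using assms leq_meet by (auto simp: u_def)
  have "leq A ((x ;; y) \<sqdot> z) (u ;; y)"
    using relmult_meet_leq_left[OF assms] by (simp add: u_def)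
  then have "leq A ((x ;; y) \<sqdot> z) ((u ;; y) \<sqdot> z)"
    using assms u(1) by (intro leq_meet(3) leq_meet(2)) simp_all
  moreover have "leq A ((u ;; y) \<sqdot> z) (u ;; (y \<sqdot> (u\<^sup>\<smile> ;; z)))"
    using assms u by (intro relmult_meet_leq_right) simp_all
  moreover have "leq A (u\<^sup>\<smile> ;; z) (x\<^sup>\<smile> ;; z)"
    using assms u by (intro relmult_leq_left conv_leq) simp_all
  then have "leq A (y \<sqdot> (u\<^sup>\<smile> ;; z)) (y \<sqdot> (x\<^sup>\<smile> ;; z))"
    using assms u(1) by (intro meet_leq_mono leq_refl) simp_all
  then have "leq A (u ;; (y \<sqdot> (u\<^sup>\<smile> ;; z))) (u ;; (y \<sqdot> (x\<^sup>\<smile> ;; z)))"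
    using assms u(1) by (intro relmult_leq_right) simp_all
  ultimately have "leq A ((x ;; y) \<sqdot> z) (u ;; (y \<sqdot> (x\<^sup>\<smile> ;; z)))"
    using assms u(1) by (meson leq_trans conv_closed meet_closed relmult_closed)
  then show "leq A ((x ;; y) \<sqdot> z) ((((z ;; y\<^sup>\<smile>) \<sqdot> x) ;; (y \<sqdot> (x\<^sup>\<smile> ;; z))) \<sqdot> z)"
    using assms unfolding u_def by (intro leq_meet(3) leq_meet(2)) simp_all
next
  let ?u = "(z ;; y\<^sup>\<smile>) \<sqdot> x" and ?w = "y \<sqdot> (x\<^sup>\<smile> ;; z)"
  have "leq A (?u ;; ?w) (x ;; ?w)"
    using assms by (intro relmult_leq_left leq_meet(2)) simp_all
  moreover have "leq A (x ;; ?w) (x ;; y)"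
    using assms by (intro relmult_leq_right leq_meet(1)) simp_all
  ultimately have "leq A (?u ;; ?w) (x ;; y)"
    using assms by (meson leq_trans conv_closed meet_closed relmult_closed)
  then show "leq A ((?u ;; ?w) \<sqdot> z) ((x ;; y) \<sqdot> z)"
    using assms by (intro meet_leq_mono leq_refl) simp_all
qed (use assms in auto)

lemma J_reduct: "J_algebra A"
proof
  fix x y z assume xyz: "x \<in> carrier A" "y \<in> carrier A" "z \<in> carrier A"
  show "x \<sqdot> (y \<sqdot> z) = (x \<sqdot> y) \<sqdot> z" using meet_assoc[OF xyz] .
  show "x ;; (y ;; z) = (x ;; y) ;; z" using relmult_assoc[OF xyz] .
  show "(x \<sqdot> y) ;; z = ((x \<sqdot> y) ;; z) \<sqdot> (y ;; z)"
    using relmult_leq_left[OF leq_meet(2)[OF xyz(1,2,3)] _ xyz(2,3)] xyz by (simp add: leq_def)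
  show "(x ;; y) \<sqdot> z = (((z ;; y\<^sup>\<smile>) \<sqdot> x) ;; (y \<sqdot> (x\<^sup>\<smile> ;; z))) \<sqdot> z"
    using rotation_law[OF xyz] .
next
  fix x y assume xy: "x \<in> carrier A" "y \<in> carrier A"
  show "x \<sqdot> y = y \<sqdot> x" using meet_comm[OF xy] .
  show "(x ;; y)\<^sup>\<smile> = y\<^sup>\<smile> ;; x\<^sup>\<smile>" using conv_relmult[OF xy] .
  show "(x \<sqdot> y)\<^sup>\<smile> = x\<^sup>\<smile> \<sqdot> y\<^sup>\<smile>" using conv_meet_distrib[OF xy] .
next
  fix x assume x: "x \<in> carrier A"
  show "x \<sqdot> x = x" "\<zero> \<sqdot> x = \<zero>" "x \<sqdot> \<one> = x"
    using x by (simp_all add: meet_idem zero_meet meet_unit)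
  show "x ;; \<one>' = x" using relmult_ident[OF x] .
  show "(x\<^sup>\<smile>)\<^sup>\<smile> = x" using conv_conv[OF x] .
  \<comment> \<open>Schroeder's law moves the trivial disjointness of
    \<open>x\<^sup>\<smile> ;; \<one>\<close> from \<open>\<zero>\<close> to that of
    \<open>x ;; \<zero>\<close> from \<open>\<one>\<close>.\<close>
  have "(x\<^sup>\<smile>\<^sup>\<smile> ;; \<zero>) \<sqdot> \<one> = \<zero>"
    using x by (intro schroeder_left[of "x\<^sup>\<smile>"]) (simp_all add: meet_zero)
  then show "x ;; \<zero> = \<zero>" using x by (simp add: conv_conv meet_unit)
qed

end

text \<open>Refuting \<open>a\<close> at a stage amounts to satisfying its complement, because the functional
  elements are total on the stage and composition distributes over joins.\<close>

lemma approximable_compl: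
  assumes ra: "relation_algebra A" and V: "J_algebra.approximable A g V" and a: "a \<in> carrier A"
  shows "V (\<sim>\<^bsub>A\<^esub> a) c d \<longleftrightarrow> \<not> V a c d"
proof -
  interpret R: relation_algebra A by fact
  interpret J_algebra A by (rule R.J_reduct)
  obtain D e f where D: "assignment D e f" "c \<in> D" "d \<in> D"
    "V a c d \<longleftrightarrow> sat e f a c d" "V (\<sim>\<^bsub>A\<^esub> a) c d \<longleftrightarrow> sat e f (\<sim>\<^bsub>A\<^esub> a) c d" "V a c d \<or> refuted e f a c d"
    using approximable_stage[OF V, of "{(a, c, d), (\<sim>\<^bsub>A\<^esub> a, c, d)}"] a by simp blast
  note asg = assignmentD[OF D(1)]
  have "\<not> (V a c d \<and> V (\<sim>\<^bsub>A\<^esub> a) c d)"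
  proof
    assume "V a c d \<and> V (\<sim>\<^bsub>A\<^esub> a) c d"
    then have "sat e f (a \<sqdot>\<^bsub>A\<^esub> \<sim>\<^bsub>A\<^esub> a) c d" using D(4,5) sat_meet[OF D(1-3) a, of "\<sim>\<^bsub>A\<^esub> a"] a by simp
    then show False using a not_sat_zero[OF D(1-3)] by simp
  qed
  moreover have "V (\<sim>\<^bsub>A\<^esub> a) c d" if "\<not> V a c d"
  proof -
    let ?p = "f c" and ?q = "f d"
    have pq: "?p \<in> carrier A" "?q \<in> carrier A" using asg D by simp_all
    have "e \<preceq> pull ?p \<one>\<^bsub>A\<^esub> ?q" using sat_unit[OF D(1-3)] by (simp add: sat_def)
    moreover have "pull ?p \<one>\<^bsub>A\<^esub> ?q = pull ?p (\<sim>\<^bsub>A\<^esub> a \<squnion>\<^bsub>A\<^esub> a) ?q" using a by simp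
    moreover have "\<dots> = pull ?p (\<sim>\<^bsub>A\<^esub> a) ?q \<squnion>\<^bsub>A\<^esub> pull ?p a ?q"
      using pq a unfolding pull_def
      by (simp add: R.relmult_join_distrib_left R.relmult_join_distrib del: R.compl_join)
    ultimately have "e \<preceq> pull ?p (\<sim>\<^bsub>A\<^esub> a) ?q \<squnion>\<^bsub>A\<^esub> pull ?p a ?q" by simp
    moreover have "e \<sqdot>\<^bsub>A\<^esub> pull ?p a ?q = \<zero>\<^bsub>A\<^esub>" using that D(6) by (simp add: refuted_def)
    ultimately have "e \<preceq> pull ?p (\<sim>\<^bsub>A\<^esub> a) ?q"
      by (rule R.disjoint_join_leq) (use pq a asg(1) in simp_all)
    then show ?thesis using D(5) by (simp add: sat_def)
  qed
  ultimately show ?thesis by blast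
qed

text \<open>The map constructed for the J-reduct already works: complements are preserved in each
  model by \<open>approximable_compl\<close>, and joins then follow by De Morgan.\<close>

lemma tabular_relation_algebra_representable:
  assumes ra: "relation_algebra A" and tab: "tabular A"
  shows "RA_representable A"
proof -
  interpret R: relation_algebra A by fact
  interpret J_algebra A by (rule R.J_reduct)
  let ?I = "carrier A - {\<zero>\<^bsub>A\<^esub>}"
  obtain V :: "'a \<Rightarrow> 'a \<Rightarrow> 'a wit \<Rightarrow> 'a wit \<Rightarrow> bool" and g
    where V: "\<And>u. u \<in> ?I \<Longrightarrow> approximable (g u) (V u)"
      and inj: "inj_on (rep_map A V ?I) (carrier A)"
      and hom: "J_hom (rep_map A V ?I) A (J_powerset (points A V ?I))"
    using ex_separating_family[OF tab] by metis
  let ?h = "rep_map A V ?I" and ?E = "points A V ?I"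
  have compl: "?h (\<sim>\<^bsub>A\<^esub> x) = ?E - ?h x" if "x \<in> carrier A" for x
    using approximable_compl[OF ra V that] by (auto simp: rep_map_def points_def)
  have meet: "?h (x \<sqdot>\<^bsub>A\<^esub> y) = ?h x \<inter> ?h y" if "x \<in> carrier A" "y \<in> carrier A" for x y
    using hom that by (simp add: J_hom_def J_powerset_def)
  have sub: "?h x \<subseteq> ?E" for x by (auto simp: rep_map_def points_def)
  have join: "?h (x \<squnion>\<^bsub>A\<^esub> y) = ?h x \<union> ?h y" if xy: "x \<in> carrier A" "y \<in> carrier A" for x y
  proof -
    have "x \<squnion>\<^bsub>A\<^esub> y = \<sim>\<^bsub>A\<^esub> (\<sim>\<^bsub>A\<^esub> x \<sqdot>\<^bsub>A\<^esub> \<sim>\<^bsub>A\<^esub> y)" using xy by (simp add: R.meet_eq)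
    then have "?h (x \<squnion>\<^bsub>A\<^esub> y) = ?E - ((?E - ?h x) \<inter> (?E - ?h y))"
      using xy by (simp add: compl meet)
    then show ?thesis using sub[of x] sub[of y] by blast
  qed
  have "RA_hom ?h A (RA_powerset ?E)"
    using hom compl join unfolding RA_hom_def J_hom_def by (simp add: J_powerset_def RA_powerset_def)
  then have "RA_representable_over ?E A"
    using equiv_points inj RA_representable_over_iff[OF R.RA_structure_axioms] by blast
  then show ?thesis by (rule RA_representableI[OF R.RA_structure_axioms])
qed

theorem theorem83:
  fixes A :: "'a J_sig" and B :: "'b RA_sig"
  shows "(J_algebra A \<and> tabular A \<longrightarrow> J_representable A) \<and>
         (relation_algebra B \<and> tabular B \<longrightarrow> RA_representable B)"
  using tabular_J_algebra_representable tabular_relation_algebra_representable by blast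

end
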